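(* Let $\mathbb F$ be $\mathbb R$ or $\mathbb C$. For any integer $p\ge 2$ and any Denjoy-Carleman class $\mathcal C^M$ which is not the class of analytic functions, there exists $f\in\mathcal C^\infty(\mathbb R^p,\mathbb F)$ satisfying: (1) $f\in\mathcal C^M(\mathbb R^p\setminus\{0\},\mathbb F)$; (2) for any real $a>0$ and integer $m\ge1$, $f\in\mathcal C^M(\mathcal S^p_{a,m},\mathbb F)$; (3) $f\in\mathcal C^M(\mathbb R^p\setminus\mathcal Q^p,\mathbb F)$; (4) $f\notin\mathcal C^M(\mathbb R^p,\mathbb F)$; where $\mathcal S^p_{a,m}:=\{x=(x_1,x_2,\dots,x_p)\in\mathbb R^p : x_1\ge0 \text{ and } x_2\ge a x_1^m\}$ and $\mathcal Q^p:=\{x=(x_1,x_2,\dots,x_p)\in\mathbb R^p : x_1>0\text{ and }x_2>0\}$. (Membership of $f$ in these sets refers to its restriction.)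
   Context: $\mathbb N$ is the set of non-negative integers. A weight sequence is a non-decreasing sequence $M=(M_n)_{n\ge 0}$ of positive real numbers with $M_0=1$ that is logarithmically convex, i.e. the ratios $M_{n+1}/M_n$ form a non-decreasing sequence; every Denjoy-Carleman class is taken with respect to such a sequence. $\mathcal C^\infty(U,\mathbb F)$ is the algebra of smooth $\mathbb F$-valued functions on an open set $U$. For $U\subseteq\mathbb R^p$ open, $\mathcal C^M(U,\mathbb F)$ is the set of $f\in\mathcal C^\infty(U,\mathbb F)$ such that for every $x\in U$ there are an open $V\subseteq U$ containing $x$ and constants $A,B>0$ with $|D^\alpha f(y)|\le A B^{|\alpha|}|\alpha|!\,M_{|\alpha|}$ for all $\alpha\in\mathbb N^p$ and all $y\in V$. The class $\mathcal C^M$ determined in this way is called a Denjoy-Carleman class; it is the class of (real-)analytic functions if and only if $\sup_{n\ge1}M_n^{1/n}<\infty$. For $C\subseteq\mathbb R^p$ closed, $f\in\mathcal C^M(C,\mathbb F)$ means that there is an open set $U\supseteq C$ with $f\in\mathcal C^\infty(U,\mathbb F)$ and, for each $x\in C$, there are an open neighbourhood $V$ of $x$ and constants $A,B>0$ such that $|D^\alpha f(y)|\le A B^{|\alpha|}|\alpha|!\,M_{|\alpha|}$ for all $\alpha\in\mathbb N^p$ and all $y\in V\cap C$. *)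

theory Defs
  imports "HOL-Analysis.Analysis"
begin

definition weight_seq :: "(nat \<Rightarrow> real) \<Rightarrow> bool" where
  "weight_seq M \<longleftrightarrow>
     M 0 = 1 \<and> (\<forall>n. M n > 0) \<and> mono M \<and> mono (\<lambda>n. M (Suc n) / M n)"

definition partial :: "'p::finite \<Rightarrow> (real^'p \<Rightarrow> 'f::real_normed_vector) \<Rightarrow> real^'p \<Rightarrow> 'f" where
  "partial i f x = frechet_derivative f (at x) (axis i 1)"

text \<open>
  Functions are total; only their values on the set in question matter, because on an open set
  the derivatives depend only on the values there. A function is smooth on an open set if all its
  iterated partial derivatives exist and are (totally) differentiable at every point of the set.
\<close>

definition smooth_on :: "(real^'p::finite) set \<Rightarrow> (real^'p \<Rightarrow> 'f::real_normed_vector) \<Rightarrow> bool" where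
  "smooth_on U f \<longleftrightarrow> (\<forall>is. \<forall>x\<in>U. foldr partial is f differentiable (at x))"

text \<open>
  A multi-index is a function \<open>\<alpha> :: 'p \<Rightarrow> nat\<close>. The order in which the partial derivatives are
  taken is irrelevant for smooth functions; an arbitrary enumeration of the coordinates fixes one.
\<close>

definition coords :: "'p::finite list" where
  "coords = (SOME xs. distinct xs \<and> set xs = UNIV)"

lemma coords: "distinct (coords :: 'p::finite list)" "set (coords :: 'p list) = UNIV"
proof -
  have "\<exists>xs :: 'p list. distinct xs \<and> set xs = UNIV"
    using finite_distinct_list[of "UNIV :: 'p set"] by auto
  then have "distinct (coords :: 'p list) \<and> set (coords :: 'p list) = UNIV"
    unfolding coords_def by (rule someI_ex)
  then show "distinct (coords :: 'p list)" "set (coords :: 'p list) = UNIV" by auto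
qed

definition mderiv ::
    "('p::finite \<Rightarrow> nat) \<Rightarrow> (real^'p \<Rightarrow> 'f::real_normed_vector) \<Rightarrow> real^'p \<Rightarrow> 'f" where
  "mderiv \<alpha> f = foldr (\<lambda>i. partial i ^^ \<alpha> i) coords f"

definition mlen :: "('p::finite \<Rightarrow> nat) \<Rightarrow> nat" where
  "mlen \<alpha> = (\<Sum>i\<in>UNIV. \<alpha> i)"

definition dc_bounds ::
    "(nat \<Rightarrow> real) \<Rightarrow> (real^'p::finite) set \<Rightarrow> (real^'p \<Rightarrow> 'f::real_normed_vector) \<Rightarrow> bool" where
  "dc_bounds M W f \<longleftrightarrow>
     (\<exists>A>0. \<exists>B>0. \<forall>\<alpha>. \<forall>y\<in>W.
        norm (mderiv \<alpha> f y) \<le> A * B ^ mlen \<alpha> * fact (mlen \<alpha>) * M (mlen \<alpha>))"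

text \<open>Membership in \<open>C\<^sup>M(U, F)\<close>, for an open set \<open>U\<close>.\<close>

definition dc_open ::
    "(nat \<Rightarrow> real) \<Rightarrow> (real^'p::finite) set \<Rightarrow> (real^'p \<Rightarrow> 'f::real_normed_vector) \<Rightarrow> bool" where
  "dc_open M U f \<longleftrightarrow>
     smooth_on U f \<and> (\<forall>x\<in>U. \<exists>V. open V \<and> x \<in> V \<and> V \<subseteq> U \<and> dc_bounds M V f)"

text \<open>
  Membership in \<open>C\<^sup>M(C, F)\<close>, for a closed set \<open>C\<close>: \<open>f\<close> is smooth on an open set around \<open>C\<close>,
  but its derivatives are estimated only at points of \<open>C\<close>.
\<close>

definition dc_closed ::
    "(nat \<Rightarrow> real) \<Rightarrow> (real^'p::finite) set \<Rightarrow> (real^'p \<Rightarrow> 'f::real_normed_vector) \<Rightarrow> bool" where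
  "dc_closed M C f \<longleftrightarrow>
     (\<exists>U. open U \<and> C \<subseteq> U \<and> smooth_on U f) \<and>
     (\<forall>x\<in>C. \<exists>V. open V \<and> x \<in> V \<and> dc_bounds M (V \<inter> C) f)"

text \<open>Real-analyticity on an open set, by (unconditionally) convergent power series.\<close>

definition real_analytic_on ::
    "(real^'p::finite) set \<Rightarrow> (real^'p \<Rightarrow> 'f::real_normed_vector) \<Rightarrow> bool" where
  "real_analytic_on U f \<longleftrightarrow>
     (\<forall>x\<in>U. \<exists>c. \<exists>r>0. \<forall>y\<in>ball x r.
        ((\<lambda>\<alpha>. (\<Prod>i\<in>UNIV. (y $ i - x $ i) ^ \<alpha> i) *\<^sub>R c \<alpha>) has_sum f y) UNIV)"

definition is_analytic_class ::
    "(nat \<Rightarrow> real) \<Rightarrow> (real^'p::finite) itself \<Rightarrow> 'f::real_normed_vector itself \<Rightarrow> bool" where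
  "is_analytic_class M _ _ \<longleftrightarrow>
     (\<forall>U (f :: real^'p \<Rightarrow> 'f). open U \<longrightarrow> (dc_open M U f \<longleftrightarrow> real_analytic_on U f))"

text \<open>The distinct coordinates \<open>i\<^sub>1\<close>, \<open>i\<^sub>2\<close> play the role of the first two of the \<open>p\<close> coordinates.\<close>

definition S_set :: "'p::finite \<Rightarrow> 'p \<Rightarrow> real \<Rightarrow> nat \<Rightarrow> (real^'p) set" where
  "S_set i\<^sub>1 i\<^sub>2 a m = {x. x $ i\<^sub>1 \<ge> 0 \<and> x $ i\<^sub>2 \<ge> a * (x $ i\<^sub>1) ^ m}"

definition Q_set :: "'p::finite \<Rightarrow> 'p \<Rightarrow> (real^'p) set" where
  "Q_set i\<^sub>1 i\<^sub>2 = {x. x $ i\<^sub>1 > 0 \<and> x $ i\<^sub>2 > 0}"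

end

theory Submission
  imports Defs
begin

text \<open>
  Take \<open>f = \<Sum>k. c\<^sub>k / (\<bar>x - P\<^sub>k\<bar>\<^sup>2 + e\<^sub>k\<^sup>2)\<close>, where the centres \<open>P\<^sub>k\<close> tend to \<open>0\<close> along a curve that is
  flat at the first axis, so that \<open>P\<^sub>k\<close> stays at a positive distance \<open>d\<^sub>k\<close> from the complement of the
  quadrant, from the other centres and, for large \<open>k\<close>, from every set \<open>x\<^sub>2 \<ge> a x\<^sub>1\<^sup>m\<close> near \<open>0\<close>. A
  derivative of order \<open>n\<close> of the \<open>k\<close>-th term is at most \<open>3\<^sup>n n! c\<^sub>k / r\<^sup>n\<^sup>+\<^sup>2\<close> at distance \<open>r\<close> from
  \<open>P\<^sub>k\<close>. As the class is not analytic, \<open>inf\<^sub>n M\<^sub>n d\<^sub>k\<^sup>n > 0\<close>, hence a small \<open>c\<^sub>k\<close> makes all these derivatives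
  at most \<open>2\<^sup>-\<^sup>k 3\<^sup>n n! M\<^sub>n\<close> at distance \<open>d\<^sub>k\<close>. Choosing \<open>e\<^sub>k\<close> much smaller still makes the derivative of order
  \<open>2k\<close> at \<open>P\<^sub>k\<close> as large as \<open>k\<^sup>2\<^sup>k (2k)! M\<^sub>2\<^sub>k\<close>, which destroys the Denjoy-Carleman bounds at \<open>0\<close>.
\<close>

subsection \<open>Families of iterated derivatives\<close>

text \<open>A whole candidate family of iterated derivatives is carried as data, the head of the
  list being the last differentiation; smoothness then follows from first-order statements about the
  family.\<close>

definition derivs_on ::
    "(real^'p::finite) set \<Rightarrow> ('p list \<Rightarrow> real^'p \<Rightarrow> 'f::real_normed_vector) \<Rightarrow> bool" where
  "derivs_on U F \<longleftrightarrow>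
     (\<forall>is. \<forall>x\<in>U. (F is has_derivative (\<lambda>h. \<Sum>i\<in>UNIV. h $ i *\<^sub>R F (i # is) x)) (at x))"

lemma sum_axis_scaleR:
  fixes g :: "'p::finite \<Rightarrow> 'f::real_vector"
  shows "(\<Sum>i\<in>UNIV. axis j (1::real) $ i *\<^sub>R g i) = g j"
proof -
  have "(\<Sum>i\<in>UNIV. axis j (1::real) $ i *\<^sub>R g i) = (\<Sum>i\<in>UNIV. if i = j then g i else 0)"
    by (intro sum.cong) (auto simp: axis_def)
  then show ?thesis by simp
qed

lemma partial_eqI:
  fixes f :: "real^'p::finite \<Rightarrow> 'f::real_normed_vector"
  assumes "(f has_derivative (\<lambda>h. \<Sum>i\<in>UNIV. h $ i *\<^sub>R g i)) (at x)"
  shows "partial i f x = g i"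
  unfolding partial_def using frechet_derivative_at[OF assms, symmetric]
  by (simp add: sum_axis_scaleR)

text \<open>Differentiability and value are proved together: equality with \<open>F is\<close> on
  all of the open set \<open>U\<close> carries the derivative of \<open>F is\<close> over to the
  iterated partial, and that derivative yields the next value.\<close>

lemma derivs_on_has_derivative:
  assumes "derivs_on U F" "open U" "\<And>x. x \<in> U \<Longrightarrow> f x = F [] x" "x \<in> U"
  shows "(foldr partial is f has_derivative (\<lambda>h. \<Sum>i\<in>UNIV. h $ i *\<^sub>R F (i # is) x)) (at x)
     \<and> foldr partial is f x = F is x"
  using assms(4)
proof (induction "is" arbitrary: x)
  case Nil
  have "(F [] has_derivative (\<lambda>h. \<Sum>i\<in>UNIV. h $ i *\<^sub>R F (i # []) x)) (at x)"
    using assms(1) Nil unfolding derivs_on_def by blast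
  then have "(f has_derivative (\<lambda>h. \<Sum>i\<in>UNIV. h $ i *\<^sub>R F (i # []) x)) (at x)"
    using assms(2,3) Nil by (metis (no_types, lifting) has_derivative_transform_within_open)
  then show ?case using assms(3) Nil by simp
next
  case (Cons j "is")
  have eq: "foldr partial (j # is) f y = F (j # is) y" if "y \<in> U" for y
    using partial_eqI[OF conjunct1[OF Cons.IH[OF that]]] by simp
  have "(F (j # is) has_derivative (\<lambda>h. \<Sum>i\<in>UNIV. h $ i *\<^sub>R F (i # j # is) x)) (at x)"
    using assms(1) Cons.prems unfolding derivs_on_def by blast
  then have "(foldr partial (j # is) f has_derivative (\<lambda>h. \<Sum>i\<in>UNIV. h $ i *\<^sub>R F (i # j # is) x)) (at x)"
    using assms(2) Cons.prems eq by (metis (no_types, lifting) has_derivative_transform_within_open)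
  then show ?case using eq Cons.prems by blast
qed

lemma derivs_on_foldr_partial:
  assumes "derivs_on U F" "open U" "\<And>x. x \<in> U \<Longrightarrow> f x = F [] x" "x \<in> U"
  shows "foldr partial is f x = F is x"
  using derivs_on_has_derivative[OF assms] by blast

lemma derivs_on_smooth_on:
  assumes "derivs_on U F" "open U" "\<And>x. x \<in> U \<Longrightarrow> f x = F [] x"
  shows "smooth_on U f"
  unfolding smooth_on_def
  using derivs_on_has_derivative[OF assms, THEN conjunct1, THEN differentiableI] by simp

text \<open>A Frechet derivative is linear, hence determined by its values on the axis vectors,
  which are the partial derivatives.\<close>

lemma smooth_on_derivs_on:
  fixes f :: "real^'p::finite \<Rightarrow> 'f::real_normed_vector"
  assumes "smooth_on U f"
  shows "derivs_on U (\<lambda>is. foldr partial is f)"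
  unfolding derivs_on_def
proof (intro allI ballI)
  fix "is" and x assume x: "x \<in> U"
  let ?g = "foldr partial is f"
  let ?D = "frechet_derivative ?g (at x)"
  have D: "(?g has_derivative ?D) (at x)"
    using assms x unfolding smooth_on_def by (simp add: frechet_derivative_works[symmetric])
  have "?D h = (\<Sum>i\<in>UNIV. h $ i *\<^sub>R foldr partial (i # is) f x)" for h
  proof -
    have lin: "linear ?D" using D has_derivative_linear by blast
    have "?D h = ?D (\<Sum>i\<in>UNIV. h $ i *\<^sub>R axis i 1)"
      by (simp add: basis_expansion scalar_mult_eq_scaleR[symmetric])
    also have "\<dots> = (\<Sum>i\<in>UNIV. h $ i *\<^sub>R ?D (axis i 1))"
      by (simp add: linear_sum[OF lin] linear_scale[OF lin])
    finally show ?thesis by (simp add: partial_def)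
  qed
  then have "?D = (\<lambda>h. \<Sum>i\<in>UNIV. h $ i *\<^sub>R foldr partial (i # is) f x)" by blast
  then show "(?g has_derivative (\<lambda>h. \<Sum>i\<in>UNIV. h $ i *\<^sub>R foldr partial (i # is) f x)) (at x)"
    using D by metis
qed

text \<open>Writes a multi-index out as the list of differentiations that \<open>mderiv\<close>
  performs, so that results on lists apply to \<open>mderiv\<close>.\<close>

definition mindex :: "('p \<Rightarrow> nat) \<Rightarrow> 'p list \<Rightarrow> 'p list" where
  "mindex \<alpha> cs = concat (map (\<lambda>i. replicate (\<alpha> i) i) cs)"

lemma foldr_funpow_eq: "foldr (\<lambda>i. g i ^^ \<alpha> i) cs f = foldr g (mindex \<alpha> cs) f"
  by (induction cs) (auto simp: mindex_def)

lemma mderiv_eq: "mderiv \<alpha> f = foldr partial (mindex \<alpha> coords) f"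
  by (simp add: mderiv_def foldr_funpow_eq)

lemma length_mindex: "distinct cs \<Longrightarrow> length (mindex \<alpha> cs) = (\<Sum>i\<in>set cs. \<alpha> i)"
  by (simp add: mindex_def length_concat o_def sum_list_distinct_conv_sum_set)

lemma length_mindex_coords: "length (mindex \<alpha> coords) = mlen \<alpha>"
  by (simp add: length_mindex coords mlen_def)

text \<open>Each \<open>mderiv \<alpha>\<close> is the iterated partial along one particular list of
  length \<open>mlen \<alpha>\<close>, so a bound over all lists suffices.\<close>

lemma dc_boundsI:
  assumes "A > 0" "B > 0"
    and "\<And>is y. y \<in> W \<Longrightarrow>
      norm (foldr partial is f y) \<le> A * B ^ length is * fact (length is) * M (length is)"
  shows "dc_bounds M W f"
  unfolding dc_bounds_def mderiv_eq
  using assms by (metis length_mindex_coords)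

section \<open>Monomials and their derivatives\<close>

definition mono_fun :: "('p::finite \<Rightarrow> nat) \<Rightarrow> real^'p \<Rightarrow> real" where
  "mono_fun \<beta> u = (\<Prod>i\<in>UNIV. (u $ i) ^ \<beta> i)"

lemma mono_fun_fun_upd: "mono_fun (\<beta>(i := n)) u = (u $ i) ^ n * (\<Prod>j\<in>UNIV - {i}. (u $ j) ^ \<beta> j)"
  unfolding mono_fun_def by (subst prod.remove[of _ i]) (auto intro!: prod.cong)

lemma mono_fun_remove: "mono_fun \<beta> u = (u $ i) ^ \<beta> i * (\<Prod>j\<in>UNIV - {i}. (u $ j) ^ \<beta> j)"
  unfolding mono_fun_def by (subst prod.remove[of _ i]) auto

lemma mlen_fun_upd: "mlen (\<beta>(i := n)) + \<beta> i = mlen \<beta> + n"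
  unfolding mlen_def by (subst (1 2) sum.remove[of _ i]) (auto intro!: sum.cong)

lemma mono_fun_has_derivative:
  fixes a :: "real^'p::finite"
  shows "((\<lambda>x. mono_fun \<beta> (x - a)) has_derivative
     (\<lambda>h. \<Sum>i\<in>UNIV. h $ i * (real (\<beta> i) * mono_fun (\<beta>(i := \<beta> i - 1)) (x - a)))) (at x)"
  unfolding mono_fun_def
proof (rule has_derivative_eq_rhs[OF has_derivative_prod])
  fix i :: 'p assume "i \<in> UNIV"
  show "((\<lambda>x. ((x - a) $ i) ^ \<beta> i) has_derivative
     (\<lambda>h. real (\<beta> i) * h $ i * ((x - a) $ i) ^ (\<beta> i - 1))) (at x)"
    by (auto intro!: derivative_eq_intros bounded_linear_imp_has_derivative bounded_linear_vec_nth)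
next
  show "(\<lambda>y. \<Sum>i\<in>UNIV. real (\<beta> i) * y $ i * (x - a) $ i ^ (\<beta> i - 1) * (\<Prod>j\<in>UNIV - {i}. (x - a) $ j ^ \<beta> j)) =
    (\<lambda>h. \<Sum>i\<in>UNIV. h $ i * (real (\<beta> i) * (\<Prod>j\<in>UNIV. (x - a) $ j ^ (\<beta>(i := \<beta> i - 1)) j)))"
    by (simp only: mono_fun_fun_upd[unfolded mono_fun_def] mult_ac)
qed

lemma abs_mono_fun_le:
  assumes "\<And>i. \<bar>u $ i\<bar> \<le> r" "0 \<le> r"
  shows "\<bar>mono_fun \<beta> u\<bar> \<le> r ^ mlen \<beta>"
proof -
  have "\<bar>mono_fun \<beta> u\<bar> = (\<Prod>i\<in>UNIV. \<bar>u $ i\<bar> ^ \<beta> i)"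
    by (simp add: mono_fun_def abs_prod power_abs)
  also have "\<dots> \<le> (\<Prod>i\<in>UNIV. r ^ \<beta> i)"
    by (intro prod_mono conjI power_mono assms) auto
  also have "\<dots> = r ^ mlen \<beta>" by (simp add: mlen_def power_sum)
  finally show ?thesis .
qed

section \<open>Termwise differentiation of series\<close>

lemma derivs_on_suminf:
  fixes F :: "nat \<Rightarrow> 'p::finite list \<Rightarrow> real^'p \<Rightarrow> 'f::banach"
  assumes U: "open U" "convex U" and F: "\<And>k. derivs_on U (F k)"
    and b: "\<And>k is x. x \<in> U \<Longrightarrow> norm (F k is x) \<le> b is k" "\<And>is. summable (b is)"
  shows "derivs_on U (\<lambda>is x. \<Sum>k. F k is x)"
  unfolding derivs_on_def
proof (intro allI ballI)
  fix "is" and x assume x: "x \<in> U"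
  let ?f' = "\<lambda>k x h. \<Sum>i\<in>UNIV. h $ i *\<^sub>R F k (i # is) x"
  let ?g' = "\<lambda>x h. \<Sum>i\<in>UNIV. h $ i *\<^sub>R (\<Sum>k. F k (i # is) x)"
  \<comment> \<open>One differentiation of the series takes convergence at a point and uniform
    convergence of the derivatives one order higher; the majorants for \<open>is\<close> and
    \<open>i # is\<close> supply both.\<close>
  have "\<exists>g. \<forall>x\<in>U. (\<lambda>k. F k is x) sums (g x) \<and> (g has_derivative ?g' x) (at x within U)"
  proof (rule has_derivative_series[OF U(2) _ _ x])
    show "(F n is has_derivative ?f' n y) (at y within U)" if "y \<in> U" for n y
      by (rule has_derivative_at_withinI) (use F[of n] that in \<open>simp add: derivs_on_def\<close>)
    show "(\<lambda>k. F k is x) sums (\<Sum>k. F k is x)"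
      using b(1)[OF x] by (intro summable_sums summable_comparison_test'[OF b(2)])
    fix e :: real assume "e > 0"
    \<comment> \<open>The error of the derivative is a sum over the coordinates with each term at
      most \<open>norm h * d\<close>.\<close>
    define d where "d = e / CARD('p)"
    have d: "d > 0" using \<open>e > 0\<close> by (simp add: d_def)
    have "\<forall>\<^sub>F n in sequentially. \<forall>y\<in>U. dist (\<Sum>k<n. F k (i # is) y) (\<Sum>k. F k (i # is) y) < d" for i
      using Weierstrass_m_test[of U "\<lambda>k. F k (i # is)" "b (i # is)", OF b(1) b(2)] d
      by (simp add: uniform_limit_iff)
    then have "\<forall>\<^sub>F n in sequentially. \<forall>i. \<forall>y\<in>U. dist (\<Sum>k<n. F k (i # is) y) (\<Sum>k. F k (i # is) y) < d"
      by (rule eventually_all_finite)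
    then show "\<forall>\<^sub>F n in sequentially. \<forall>y\<in>U. \<forall>h. norm ((\<Sum>k<n. ?f' k y h) - ?g' y h) \<le> e * norm h"
    proof (rule eventually_mono, intro ballI allI)
      fix n y h assume n: "\<forall>i. \<forall>y\<in>U. dist (\<Sum>k<n. F k (i # is) y) (\<Sum>k. F k (i # is) y) < d" and y: "y \<in> U"
      have "(\<Sum>k<n. ?f' k y h) = (\<Sum>i\<in>UNIV. h $ i *\<^sub>R (\<Sum>k<n. F k (i # is) y))"
        by (subst sum.swap) (simp add: scaleR_sum_right)
      then have "(\<Sum>k<n. ?f' k y h) - ?g' y h
          = (\<Sum>i\<in>UNIV. h $ i *\<^sub>R ((\<Sum>k<n. F k (i # is) y) - (\<Sum>k. F k (i # is) y)))"
        by (simp add: sum_subtractf scaleR_diff_right)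
      also have "norm \<dots> \<le> (\<Sum>i\<in>(UNIV :: 'p set). norm h * d)"
        using n y
        by (intro sum_norm_le) (simp add: dist_norm mult_mono less_imp_le component_le_norm_cart)
      also have "\<dots> = e * norm h" by (simp add: d_def)
      finally show "norm ((\<Sum>k<n. ?f' k y h) - ?g' y h) \<le> e * norm h" .
    qed
  qed
  then obtain g where g': "\<forall>y\<in>U. (\<lambda>k. F k is y) sums (g y) \<and> (g has_derivative ?g' y) (at y within U)" ..
  have g: "(\<lambda>k. F k is y) sums (g y)" "(g has_derivative ?g' y) (at y within U)" if "y \<in> U" for y
    by (rule conjunct1[OF bspec[OF g' that]], rule conjunct2[OF bspec[OF g' that]])
  have "(g has_derivative ?g' x) (at x)" using g(2)[OF x] unfolding at_within_open[OF x U(1)] .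
  then show "((\<lambda>x. \<Sum>k. F k is x) has_derivative ?g' x) (at x)"
    by (rule has_derivative_transform_within_open[OF _ U(1) x]) (simp add: g(1) sums_unique)
qed

lemma derivs_on_scaleR_const:
  fixes F :: "'p::finite list \<Rightarrow> real^'p \<Rightarrow> real"
  assumes "derivs_on U F"
  shows "derivs_on U (\<lambda>is x. F is x *\<^sub>R v)"
  unfolding derivs_on_def
proof (intro allI ballI)
  fix "is" and x assume "x \<in> U"
  then have "(F is has_derivative (\<lambda>h. \<Sum>i\<in>UNIV. h $ i *\<^sub>R F (i # is) x)) (at x)"
    using assms unfolding derivs_on_def by blast
  from has_derivative_scaleR_left[OF this, of v]
  show "((\<lambda>x. F is x *\<^sub>R v) has_derivative (\<lambda>h. \<Sum>i\<in>UNIV. h $ i *\<^sub>R F (i # is) x *\<^sub>R v)) (at x)"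
    by (simp add: scaleR_sum_left)
qed

subsection \<open>Derivatives of an inverse quadratic\<close>

text \<open>On a unit-speed line through \<open>P\<close> this is t^2 + s^2, whose complex zeros lie
  at distance |s| from the centre: for small s \<noteq> 0 the inverse is smooth but has large
  derivatives at \<open>P\<close>.\<close>

definition pole :: "real^'p::finite \<Rightarrow> real \<Rightarrow> real^'p \<Rightarrow> real" where
  "pole P s x = (norm (x - P))\<^sup>2 + s\<^sup>2"

lemma pole_pos: "s \<noteq> 0 \<Longrightarrow> pole P s x > 0"
  by (simp add: pole_def add_nonneg_pos)

lemma pole_has_derivative:
  "(pole P s has_derivative (\<lambda>h. \<Sum>i\<in>UNIV. h $ i * (2 * (x - P) $ i))) (at x)"
proof -
  have "((\<lambda>x. (x - P) \<bullet> (x - P) + s\<^sup>2) has_derivative (\<lambda>h. (x - P) \<bullet> h + h \<bullet> (x - P))) (at x)"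
    by (auto intro!: derivative_eq_intros)
  moreover have "(\<lambda>x. (x - P) \<bullet> (x - P) + s\<^sup>2) = pole P s"
    by (auto simp: pole_def dot_square_norm)
  moreover have "(x - P) \<bullet> h + h \<bullet> (x - P) = (\<Sum>i\<in>UNIV. h $ i * (2 * (x - P) $ i))" for h
    by (simp add: inner_vec_def sum.distrib[symmetric] algebra_simps)
  ultimately show ?thesis by simp
qed

text \<open>
  Sums of terms \<open>c u\<^sup>\<beta> / q\<^sup>m\<close> of homogeneity \<open>- (n + 2)\<close> in \<open>(u, s)\<close> whose coefficients add up to at most
  \<open>K\<close>. Since \<open>m \<le> n + 1\<close>, a differentiation enlarges \<open>K\<close> at most by the factor \<open>3 (n + 1)\<close>.
\<close>

inductive rat_class :: "real^'p::finite \<Rightarrow> real \<Rightarrow> nat \<Rightarrow> real \<Rightarrow> (real^'p \<Rightarrow> real) \<Rightarrow> bool"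
  for P s where
  monomial: "\<lbrakk>mlen \<beta> + n + 2 = 2 * m; m \<le> n + 1; \<bar>c\<bar> \<le> K\<rbrakk> \<Longrightarrow>
    rat_class P s n K (\<lambda>x. c * mono_fun \<beta> (x - P) / pole P s x ^ m)"
| zero: "0 \<le> K \<Longrightarrow> rat_class P s n K (\<lambda>x. 0)"
| add: "\<lbrakk>rat_class P s n K f; rat_class P s n L g; K + L \<le> R\<rbrakk> \<Longrightarrow> rat_class P s n R (\<lambda>x. f x + g x)"

text \<open>With r the root of the pole, every coordinate of x - P is at most r in absolute value,
  so a monomial is at most K r^|\<beta>| / r^(2m), which homogeneity turns into K / r^(n+2).\<close>

lemma rat_class_bound:
  assumes "rat_class P s n K f" "s \<noteq> 0"
  shows "\<bar>f x\<bar> \<le> K / sqrt (pole P s x) ^ (n + 2)"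
  using assms(1)
proof induction
  case (monomial \<beta> n m c K)
  define r where "r = sqrt (pole P s x)"
  have q: "pole P s x > 0" by (rule pole_pos[OF assms(2)])
  have r: "r > 0" "pole P s x = r\<^sup>2" using q by (auto simp: r_def)
  have "\<bar>(x - P) $ i\<bar> \<le> r" for i
  proof -
    have "norm (x - P) \<le> r" unfolding r_def pole_def by (rule real_le_rsqrt) simp
    then show ?thesis using component_le_norm_cart[of "x - P" i] by linarith
  qed
  then have b: "\<bar>mono_fun \<beta> (x - P)\<bar> \<le> r ^ mlen \<beta>" using abs_mono_fun_le r(1) by (metis less_eq_real_def)
  have "\<bar>c * mono_fun \<beta> (x - P) / pole P s x ^ m\<bar> = \<bar>c\<bar> * \<bar>mono_fun \<beta> (x - P)\<bar> / r ^ (2 * m)"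
    using r by (simp add: abs_mult power_mult)
  also have "\<dots> \<le> K * r ^ mlen \<beta> / r ^ (2 * m)"
    using b r monomial by (intro divide_right_mono mult_mono) auto
  also have "\<dots> = K / r ^ (n + 2)"
    using r unfolding monomial(1)[symmetric] by (simp add: power_add field_simps)
  finally show ?case unfolding r_def .
next
  case (zero K n)
  then show ?case using pole_pos[OF assms(2), of P x] by (simp add: less_imp_le)
next
  case (add n K f L g R)
  have "\<bar>f x + g x\<bar> \<le> K / sqrt (pole P s x) ^ (n + 2) + L / sqrt (pole P s x) ^ (n + 2)"
    using add by linarith
  also have "\<dots> \<le> R / sqrt (pole P s x) ^ (n + 2)"
    using add pole_pos[OF assms(2), of P x]
    by (simp add: add_divide_distrib[symmetric] divide_right_mono)
  finally show ?case .
qed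

text \<open>The quotient rule yields two monomials of homogeneity one lower: one of weight
  \<open>\<beta> i\<close> from the numerator, one of weight 2m from the denominator.\<close>

lemma rat_class_deriv:
  assumes "rat_class P s n K f" "s \<noteq> 0"
  shows "\<exists>g. (\<forall>x. (f has_derivative (\<lambda>h. \<Sum>i\<in>UNIV. h $ i *\<^sub>R g i x)) (at x)) \<and>
    (\<forall>i. rat_class P s (n + 1) (real (3 * (n + 1)) * K) (g i))"
  using assms(1)
proof induction
  case (monomial \<beta> n m c K)
  let ?g = "\<lambda>i x. (c * \<beta> i) * mono_fun (\<beta>(i := \<beta> i - 1)) (x - P) / pole P s x ^ m
      + (- 2 * m * c) * mono_fun (\<beta>(i := \<beta> i + 1)) (x - P) / pole P s x ^ (m + 1)"
  have m: "m \<ge> 1" using monomial by auto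
  have "((\<lambda>x. c * mono_fun \<beta> (x - P) / pole P s x ^ m) has_derivative
      (\<lambda>h. \<Sum>i\<in>UNIV. h $ i *\<^sub>R ?g i x)) (at x)" for x
  proof -
    define q where "q = pole P s x"
    have q: "q > 0" unfolding q_def by (rule pole_pos[OF assms(2)])
    have D: "((\<lambda>x. c * mono_fun \<beta> (x - P) / pole P s x ^ m) has_derivative
      (\<lambda>h. (c * (\<Sum>i\<in>UNIV. h $ i * (real (\<beta> i) * mono_fun (\<beta>(i := \<beta> i - 1)) (x - P))) * q ^ m
         - c * mono_fun \<beta> (x - P) * (m * (\<Sum>i\<in>UNIV. h $ i * (2 * (x - P) $ i)) * q ^ (m - 1))) / (q ^ m * q ^ m))) (at x)"
      unfolding q_def
      by (rule has_derivative_divide'[OF has_derivative_mult_right[OF mono_fun_has_derivative]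
            has_derivative_power[OF pole_has_derivative]])
        (use q in \<open>simp add: q_def\<close>)
    have "(c * (\<Sum>i\<in>UNIV. h $ i * (real (\<beta> i) * mono_fun (\<beta>(i := \<beta> i - 1)) (x - P))) * q ^ m
         - c * mono_fun \<beta> (x - P) * (m * (\<Sum>i\<in>UNIV. h $ i * (2 * (x - P) $ i)) * q ^ (m - 1))) / (q ^ m * q ^ m)
        = (\<Sum>i\<in>UNIV. h $ i *\<^sub>R ?g i x)" for h
    proof -
      have "?g i x = (real (\<beta> i) * mono_fun (\<beta>(i := \<beta> i - 1)) (x - P) * c * q ^ m
          - c * mono_fun \<beta> (x - P) * (m * (2 * (x - P) $ i) * q ^ (m - 1))) / (q ^ m * q ^ m)" for i
      proof -
        have e: "mono_fun (\<beta>(i := \<beta> i + 1)) (x - P) = (x - P) $ i * mono_fun \<beta> (x - P)"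
          by (simp add: mono_fun_fun_upd mono_fun_remove[of \<beta> _ i])
        obtain k where k: "m = Suc k" using m by (cases m) auto
        show ?thesis using q unfolding e q_def[symmetric] k by (simp add: field_simps)
      qed
      then show ?thesis
        by (simp add: sum_distrib_left sum_distrib_right sum_subtractf[symmetric] sum_divide_distrib algebra_simps)
    qed
    then show ?thesis using D by simp
  qed
  moreover have "rat_class P s (n + 1) (real (3 * (n + 1)) * K) (?g i)" for i
  proof (rule rat_class.add)
    show "rat_class P s (n + 1) (\<beta> i * K) (\<lambda>x. (c * \<beta> i) * mono_fun (\<beta>(i := \<beta> i - 1)) (x - P) / pole P s x ^ m)"
    \<comment> \<open>At exponent 0 the truncated \<open>\<beta> i - 1\<close> would spoil the
      homogeneity count, but then the coefficient is zero.\<close>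
    proof (cases "\<beta> i = 0")
      case True then show ?thesis using rat_class.zero[of 0] by simp
    next
      case False
      show ?thesis
      proof (rule rat_class.monomial)
        show "mlen (\<beta>(i := \<beta> i - 1)) + (n + 1) + 2 = 2 * m"
          using mlen_fun_upd[of \<beta> i "\<beta> i - 1"] False monomial(1) by linarith
      qed (use monomial in \<open>auto simp: abs_mult mult.commute intro!: mult_right_mono\<close>)
    qed
    show "rat_class P s (n + 1) (2 * m * K) (\<lambda>x. (- 2 * m * c) * mono_fun (\<beta>(i := \<beta> i + 1)) (x - P) / pole P s x ^ (m + 1))"
    proof (rule rat_class.monomial)
      show "mlen (\<beta>(i := \<beta> i + 1)) + (n + 1) + 2 = 2 * (m + 1)"
        using mlen_fun_upd[of \<beta> i "\<beta> i + 1"] monomial(1) by simp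
    qed (use monomial in \<open>auto simp: abs_mult mult.commute intro!: mult_right_mono\<close>)
    have "\<beta> i \<le> mlen \<beta>" unfolding mlen_def by (rule member_le_sum) auto
    \<comment> \<open>Homogeneity and m \<le> n + 1 give \<open>mlen \<beta>\<close> \<le> n and 2m
      \<le> 2n + 2.\<close>
    then have "\<beta> i + 2 * m \<le> 3 * (n + 1)" using monomial(1,2) by presburger
    then have "real (\<beta> i + 2 * m) \<le> real (3 * (n + 1))" using of_nat_mono by blast
    then have "real (\<beta> i + 2 * m) * K \<le> real (3 * (n + 1)) * K"
      using monomial by (intro mult_right_mono) auto
    then show "\<beta> i * K + 2 * m * K \<le> real (3 * (n + 1)) * K" by (simp add: algebra_simps)
  qed
  ultimately show ?case by (intro exI[of _ ?g]) blast
next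
  case (zero K n)
  show ?case
    by (intro exI[of _ "\<lambda>_ _. 0"]) (use zero in \<open>auto intro!: rat_class.zero\<close>)
next
  case (add n K f L g R)
  then obtain f' g' where
    f': "\<And>x. (f has_derivative (\<lambda>h. \<Sum>i\<in>UNIV. h $ i *\<^sub>R f' i x)) (at x)"
      "\<And>i. rat_class P s (n + 1) (real (3 * (n + 1)) * K) (f' i)" and
    g': "\<And>x. (g has_derivative (\<lambda>h. \<Sum>i\<in>UNIV. h $ i *\<^sub>R g' i x)) (at x)"
      "\<And>i. rat_class P s (n + 1) (real (3 * (n + 1)) * L) (g' i)" by blast
  have "((\<lambda>x. f x + g x) has_derivative (\<lambda>h. \<Sum>i\<in>UNIV. h $ i *\<^sub>R (f' i x + g' i x))) (at x)" for x
    using has_derivative_add[OF f'(1) g'(1), of x] by (simp add: sum.distrib[symmetric] algebra_simps)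
  moreover have "rat_class P s (n + 1) (real (3 * (n + 1)) * R) (\<lambda>x. f' i x + g' i x)" for i
  proof (rule rat_class.add[OF f'(2) g'(2)])
    have "real (3 * (n + 1)) * (K + L) \<le> real (3 * (n + 1)) * R"
      using add by (intro mult_left_mono) auto
    then show "real (3 * (n + 1)) * K + real (3 * (n + 1)) * L \<le> real (3 * (n + 1)) * R"
      by (simp add: algebra_simps)
  qed
  ultimately show ?case by (intro exI[of _ "\<lambda>i x. f' i x + g' i x"]) blast
qed

text \<open>The induction keeps the rational shape and not only its bound, because the next
  differentiation acts on the shape. The factors 3 (n + 1) multiply to 3^n n!.\<close>

lemma inverse_pole_foldr_partial:
  assumes "s \<noteq> 0"
  shows "rat_class P s (length is) (3 ^ length is * fact (length is)) (foldr partial is (\<lambda>x. 1 / pole P s x))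
    \<and> (\<forall>x. foldr partial is (\<lambda>x. 1 / pole P s x) differentiable (at x))"
proof (induction "is")
  case Nil
  have "rat_class P s 0 1 (\<lambda>x. 1 * mono_fun (\<lambda>_. 0) (x - P) / pole P s x ^ 1)"
    by (rule rat_class.monomial) (auto simp: mlen_def)
  then have *: "rat_class P s 0 1 (\<lambda>x. 1 / pole P s x)" by (simp add: mono_fun_def)
  show ?case using * rat_class_deriv[OF * assms] unfolding differentiable_def by auto
next
  case (Cons i "is")
  let ?f = "foldr partial is (\<lambda>x. 1 / pole P s x)"
  from rat_class_deriv[OF conjunct1[OF Cons] assms] obtain g where
    g: "\<And>x. (?f has_derivative (\<lambda>h. \<Sum>i\<in>UNIV. h $ i *\<^sub>R g i x)) (at x)"
    and r: "\<And>i. rat_class P s (length is + 1) (real (3 * (length is + 1)) * (3 ^ length is * fact (length is))) (g i)"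
    by blast
  have eq: "foldr partial (i # is) (\<lambda>x. 1 / pole P s x) = g i"
    using partial_eqI[OF g] by auto
  have "real (3 * (length is + 1)) * (3 ^ length is * fact (length is)) = 3 ^ length (i # is) * fact (length (i # is))"
    by (simp add: algebra_simps)
  then have *: "rat_class P s (length (i # is)) (3 ^ length (i # is) * fact (length (i # is))) (g i)"
    using r[of i] by (metis Suc_eq_plus1 length_Cons)
  show ?case unfolding eq using * rat_class_deriv[OF * assms] unfolding differentiable_def by blast
qed

lemma inverse_pole_bound:
  assumes "s \<noteq> 0"
  shows "\<bar>foldr partial is (\<lambda>x. 1 / pole P s x) x\<bar>
    \<le> 3 ^ length is * fact (length is) / sqrt (pole P s x) ^ (length is + 2)"
  using rat_class_bound[OF conjunct1[OF inverse_pole_foldr_partial] assms] assms by blast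

lemma inverse_pole_derivs_on:
  assumes "s \<noteq> 0"
  shows "derivs_on UNIV (\<lambda>is. foldr partial is (\<lambda>x. 1 / pole P s x))"
  by (rule smooth_on_derivs_on) (simp add: smooth_on_def inverse_pole_foldr_partial[OF assms])

section \<open>Axis-parallel lines and the derivatives at the centre of a pole\<close>

lemma derivs_on_line:
  fixes F :: "'p::finite list \<Rightarrow> real^'p \<Rightarrow> 'f::real_normed_vector"
  assumes "derivs_on U F" "x + t *\<^sub>R axis i 1 \<in> U"
  shows "((\<lambda>t. F is (x + t *\<^sub>R axis i 1)) has_vector_derivative F (i # is) (x + t *\<^sub>R axis i 1)) (at t)"
proof -
  have D: "(F is has_derivative (\<lambda>h. \<Sum>j\<in>UNIV. h $ j *\<^sub>R F (j # is) (x + t *\<^sub>R axis i 1))) (at (x + t *\<^sub>R axis i 1))"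
    using assms unfolding derivs_on_def by blast
  have "((\<lambda>t. x + t *\<^sub>R axis i 1) has_derivative (\<lambda>t. t *\<^sub>R axis i 1)) (at t)"
    by (auto intro!: derivative_eq_intros)
  from has_derivative_compose[OF this D]
  show ?thesis
    by (simp add: has_vector_derivative_def sum_axis_scaleR scaleR_sum_right[symmetric]
        scaleR_scaleR[symmetric] del: scaleR_scaleR)
qed

text \<open>Repeated differentiation of \<open>(t\<^sup>2 + s\<^sup>2) g = 1\<close> yields a three-term recurrence for the derivatives of \<open>g\<close>.\<close>

lemma inverse_quadratic_deriv_zero:
  fixes G :: "nat \<Rightarrow> real \<Rightarrow> real"
  assumes "s \<noteq> 0" and G0: "\<And>t. G 0 t = 1 / (t\<^sup>2 + s\<^sup>2)"
    and G: "\<And>n t. (G n has_real_derivative G (Suc n) t) (at t)"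
  shows "\<bar>G (2 * k) 0\<bar> = fact (2 * k) / s ^ (2 * k + 2)"
proof -
  have 1: "2 * t * G 0 t + (t\<^sup>2 + s\<^sup>2) * G 1 t = 0" for t
  proof -
    have q: "t\<^sup>2 + s\<^sup>2 > 0" for t using assms(1) by (simp add: add_nonneg_pos)
    have "((\<lambda>t. (t\<^sup>2 + s\<^sup>2) * G 0 t) has_real_derivative (2 * t * G 0 t + (t\<^sup>2 + s\<^sup>2) * G (Suc 0) t)) (at t)"
      by (auto intro!: derivative_eq_intros G)
    moreover have "(\<lambda>t. (t\<^sup>2 + s\<^sup>2) * G 0 t) = (\<lambda>t. 1)" using q by (intro ext) (simp add: G0 assms(1))
    ultimately show ?thesis using DERIV_unique[of "\<lambda>t. 1" _ t 0] by simp
  qed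
  have 2: "(t\<^sup>2 + s\<^sup>2) * G (n + 2) t + 2 * (real n + 2) * t * G (n + 1) t + (real n + 2) * (real n + 1) * G n t = 0" for n t
  proof (induction n arbitrary: t)
    case 0
    have "((\<lambda>t. 2 * t * G 0 t + (t\<^sup>2 + s\<^sup>2) * G 1 t) has_real_derivative
      (2 * G 0 t + 2 * t * G 1 t + (2 * t * G 1 t + (t\<^sup>2 + s\<^sup>2) * G 2 t))) (at t)"
      by (auto intro!: derivative_eq_intros G simp: eval_nat_numeral)
    then have "2 * G 0 t + 2 * t * G 1 t + (2 * t * G 1 t + (t\<^sup>2 + s\<^sup>2) * G 2 t) = 0"
      using DERIV_unique[of "\<lambda>t. 0" _ t 0] unfolding 1 by simp
    then show ?case by (simp add: eval_nat_numeral algebra_simps)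
  next
    case (Suc n)
    have "((\<lambda>t. (t\<^sup>2 + s\<^sup>2) * G (n + 2) t + 2 * (real n + 2) * t * G (n + 1) t + (real n + 2) * (real n + 1) * G n t)
      has_real_derivative (2 * t * G (n + 2) t + (t\<^sup>2 + s\<^sup>2) * G (n + 3) t
        + (2 * (real n + 2) * G (n + 1) t + 2 * (real n + 2) * t * G (n + 2) t) + (real n + 2) * (real n + 1) * G (n + 1) t)) (at t)"
      by (auto intro!: derivative_eq_intros G simp: eval_nat_numeral)
    then have "2 * t * G (n + 2) t + (t\<^sup>2 + s\<^sup>2) * G (n + 3) t
        + (2 * (real n + 2) * G (n + 1) t + 2 * (real n + 2) * t * G (n + 2) t) + (real n + 2) * (real n + 1) * G (n + 1) t = 0"
      using DERIV_unique[of "\<lambda>t. 0" _ t 0] unfolding Suc by simp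
    then show ?case by (simp add: eval_nat_numeral algebra_simps)
  qed
  show ?thesis
  proof (induction k)
    case 0
    then show ?case by (simp add: G0 power2_eq_square)
  next
    case (Suc k)
    \<comment> \<open>At t = 0 the middle term of the recurrence drops out, so it links the orders
      2k and 2k + 2 directly.\<close>
    have e: "s\<^sup>2 * G (2 * k + 2) 0 = - (real (2 * k) + 2) * (real (2 * k) + 1) * G (2 * k) 0"
      using 2[of 0 "2 * k"] by (simp add: algebra_simps)
    have "s\<^sup>2 * \<bar>G (2 * k + 2) 0\<bar> = \<bar>s\<^sup>2 * G (2 * k + 2) 0\<bar>"
      by (simp add: abs_mult)
    also have "\<dots> = (real (2 * k) + 2) * (real (2 * k) + 1) * \<bar>G (2 * k) 0\<bar>"
      unfolding e by (simp add: abs_mult)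
    also have "\<dots> = fact (2 * k + 2) / s ^ (2 * k + 2)"
      unfolding Suc by (simp add: field_simps)
    finally show ?case using assms(1) by (simp add: field_simps power2_eq_square)
  qed
qed

text \<open>On the axis-parallel line through \<open>P\<close> the function is 1 / (t^2 + s^2). The
  exact value later furnishes the lower bound for the sum of poles at its centres.\<close>

lemma inverse_pole_partial_center:
  fixes P :: "real^'p::finite"
  assumes "s \<noteq> 0"
  shows "\<bar>foldr partial (replicate (2 * k) i) (\<lambda>x. 1 / pole P s x) P\<bar> = fact (2 * k) / s ^ (2 * k + 2)"
proof -
  define F where "F = (\<lambda>is. foldr partial is (\<lambda>x. 1 / pole P s x))"
  define G where "G n t = F (replicate n i) (P + t *\<^sub>R axis i 1)" for n t
  have "\<bar>G (2 * k) 0\<bar> = fact (2 * k) / s ^ (2 * k + 2)"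
  proof (rule inverse_quadratic_deriv_zero[OF assms])
    show "G 0 t = 1 / (t\<^sup>2 + s\<^sup>2)" for t
      by (simp add: G_def F_def pole_def)
    show "(G n has_real_derivative G (Suc n) t) (at t)" for n t
      unfolding G_def F_def has_real_derivative_iff_has_vector_derivative replicate_Suc
      by (rule derivs_on_line[OF inverse_pole_derivs_on[OF assms]]) simp
  qed
  then show ?thesis by (simp add: G_def F_def)
qed

subsection \<open>Bounded weights give the analytic functions\<close>

lemma has_sum_imp_bounded:
  fixes f :: "'a \<Rightarrow> 'b::real_normed_vector"
  assumes "(f has_sum S) A"
  shows "\<exists>K>0. \<forall>x\<in>A. norm (f x) \<le> K"
proof -
  have "\<forall>\<^sub>F X in finite_subsets_at_top A. dist (sum f X) S < 1"
    using assms unfolding has_sum_def by (rule tendstoD) simp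
  then obtain X where X: "finite X" "X \<subseteq> A"
    and d: "\<forall>Y. finite Y \<and> X \<subseteq> Y \<and> Y \<subseteq> A \<longrightarrow> dist (sum f Y) S < 1"
    unfolding eventually_finite_subsets_at_top by blast
  have "norm (f x) \<le> 2 + (\<Sum>y\<in>X. norm (f y))" if "x \<in> A" for x
  proof (cases "x \<in> X")
    case True
    then have "norm (f x) \<le> (\<Sum>y\<in>X. norm (f y))" using X by (intro member_le_sum) auto
    then show ?thesis by simp
  next
    case False
    \<comment> \<open>The term is the difference of two finite sums that both lie within 1 of the
      limit.\<close>
    have "dist (sum f (insert x X)) S < 1" "dist (sum f X) S < 1"
      using d X that by auto
    then have "dist (sum f (insert x X)) (sum f X) < 2"
      using dist_triangle2[of "sum f (insert x X)" "sum f X" S] by linarith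
    then have "norm (f x) < 2" using False X by (simp add: dist_norm)
    then show ?thesis using sum_nonneg[of X "\<lambda>y. norm (f y)"] by simp
  qed
  moreover have "2 + (\<Sum>y\<in>X. norm (f y)) > 0" by (simp add: add_pos_nonneg sum_nonneg)
  ultimately show ?thesis by blast
qed

text \<open>A finite set of multi-indices lies in a cube, and over a cube the sum factors into one
  geometric sum per coordinate, each at most 2.\<close>

lemma summable_on_half_power_mlen:
  "(\<lambda>\<alpha> :: 'p::finite \<Rightarrow> nat. (1 / 2 :: real) ^ mlen \<alpha>) summable_on UNIV"
proof (rule nonneg_bdd_above_summable_on)
  show "bdd_above (sum (\<lambda>\<alpha> :: 'p \<Rightarrow> nat. (1 / 2 :: real) ^ mlen \<alpha>) ` {F. F \<subseteq> UNIV \<and> finite F})"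
  proof (rule bdd_aboveI2)
    fix F :: "('p \<Rightarrow> nat) set" assume "F \<in> {F. F \<subseteq> UNIV \<and> finite F}"
    then have F: "finite F" by simp
    define n where "n = Max (insert 0 (mlen ` F))"
    have "\<alpha> i \<le> n" if "\<alpha> \<in> F" for \<alpha> i
    proof -
      have "\<alpha> i \<le> mlen \<alpha>" unfolding mlen_def by (rule member_le_sum) auto
      also have "\<dots> \<le> n" unfolding n_def using F that by (intro Max_ge) auto
      finally show ?thesis .
    qed
    then have sub: "F \<subseteq> PiE UNIV (\<lambda>_. {..n})" by auto
    have "(\<Sum>\<alpha>\<in>F. (1 / 2 :: real) ^ mlen \<alpha>) \<le> (\<Sum>\<alpha>\<in>PiE (UNIV :: 'p set) (\<lambda>_. {..n}). (1 / 2 :: real) ^ mlen \<alpha>)"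
      by (rule sum_mono2[OF _ sub]) (simp_all add: finite_PiE)
    also have "\<dots> = (\<Prod>i\<in>(UNIV :: 'p set). \<Sum>a\<le>n. (1 / 2 :: real) ^ a)"
      by (subst prod_sum_PiE) (auto simp: mlen_def power_sum)
    also have "\<dots> \<le> (\<Prod>i\<in>(UNIV :: 'p set). 2)"
    proof (rule prod_mono)
      have "(\<Sum>a\<le>n. (1 / 2 :: real) ^ a) = 2 - (1 / 2) ^ n"
        by (induction n) auto
      then have "(\<Sum>a\<le>n. (1 / 2 :: real) ^ a) \<le> 2" by simp
      then show "0 \<le> (\<Sum>a\<le>n. (1 / 2 :: real) ^ a) \<and> (\<Sum>a\<le>n. (1 / 2 :: real) ^ a) \<le> 2"
        by (simp add: sum_nonneg)
    qed
    finally show "(\<Sum>\<alpha>\<in>F. (1 / 2 :: real) ^ mlen \<alpha>) \<le> (\<Prod>i\<in>(UNIV :: 'p set). 2)" .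
  qed
qed auto

text \<open>Turns unordered sums over multi-indices into series over the naturals, to which
  \<open>derivs_on_suminf\<close> applies.\<close>

lemma enumerate_multi_indices:
  obtains e :: "nat \<Rightarrow> ('p::finite \<Rightarrow> nat)" where "bij_betw e UNIV UNIV"
proof -
  have "inj (\<lambda>n :: nat. (\<lambda>_ :: 'p. n))" by (auto simp: inj_def dest: fun_cong)
  then have "infinite (range (\<lambda>n :: nat. (\<lambda>_ :: 'p. n)))" by (simp add: finite_image_iff)
  then have "infinite (UNIV :: ('p \<Rightarrow> nat) set)" by (rule infinite_super[OF subset_UNIV])
  then show ?thesis
    using that bij_betw_from_nat_into[of "UNIV :: ('p \<Rightarrow> nat) set"] by auto
qed

text \<open>The truncated subtraction is harmless: once an exponent is exhausted, \<open>dcoef\<close> vanishes.\<close>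

primrec dexp :: "'p list \<Rightarrow> ('p \<Rightarrow> nat) \<Rightarrow> 'p \<Rightarrow> nat" where
  "dexp [] \<alpha> = \<alpha>"
| "dexp (i # is) \<alpha> = (dexp is \<alpha>)(i := dexp is \<alpha> i - 1)"

primrec dcoef :: "'p list \<Rightarrow> ('p \<Rightarrow> nat) \<Rightarrow> real" where
  "dcoef [] \<alpha> = 1"
| "dcoef (i # is) \<alpha> = dcoef is \<alpha> * real (dexp is \<alpha> i)"

section \<open>Derivatives of convergent power series\<close>

lemma mono_fun_derivs_on:
  "derivs_on UNIV (\<lambda>is x. dcoef is \<alpha> * mono_fun (dexp is \<alpha>) (x - a))"
  unfolding derivs_on_def
proof (intro allI ballI)
  fix "is" x
  show "((\<lambda>x. dcoef is \<alpha> * mono_fun (dexp is \<alpha>) (x - a)) has_derivative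
    (\<lambda>h. \<Sum>i\<in>UNIV. h $ i *\<^sub>R (dcoef (i # is) \<alpha> * mono_fun (dexp (i # is) \<alpha>) (x - a)))) (at x)"
    using has_derivative_mult_right[OF mono_fun_has_derivative[of "dexp is \<alpha>" a x], of "dcoef is \<alpha>"]
    by (simp add: sum_distrib_left mult_ac)
qed

lemma dcoef_nonneg: "dcoef is \<alpha> \<ge> 0"
  by (induction "is") auto

text \<open>Each differentiation multiplies by one exponent, which is at most the current total
  degree; hence the falling factorial |\<alpha>|! / (|\<alpha>| - n)! as a bound. The first
  alternative covers an exhausted exponent.\<close>

lemma dcoef_bound:
  "dcoef is \<alpha> = 0 \<or> mlen (dexp is \<alpha>) + length is = mlen \<alpha> \<and> dcoef is \<alpha> * fact (mlen (dexp is \<alpha>)) \<le> fact (mlen \<alpha>)"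
proof (induction "is")
  case Nil
  then show ?case by simp
next
  case (Cons i "is")
  show ?case
  proof (cases "dcoef (i # is) \<alpha> = 0")
    case False
    then have nz: "dexp is \<alpha> i \<noteq> 0" "dcoef is \<alpha> \<noteq> 0" by auto
    let ?N = "mlen (dexp (i # is) \<alpha>)"
    have N: "mlen (dexp is \<alpha>) = Suc ?N"
      using mlen_fun_upd[of "dexp is \<alpha>" i "dexp is \<alpha> i - 1"] nz by simp
    have "dexp is \<alpha> i \<le> mlen (dexp is \<alpha>)" unfolding mlen_def by (rule member_le_sum) auto
    then have "dcoef (i # is) \<alpha> * fact ?N \<le> dcoef is \<alpha> * real (Suc ?N) * fact ?N"
      unfolding N by (auto intro!: mult_right_mono mult_left_mono dcoef_nonneg simp del: of_nat_Suc)
    also have "\<dots> = dcoef is \<alpha> * fact (mlen (dexp is \<alpha>))" unfolding N by simp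
    also have "\<dots> \<le> fact (mlen \<alpha>)" using Cons nz by blast
    finally show ?thesis using Cons nz(2) N by (simp del: dexp.simps dcoef.simps)
  qed simp
qed

text \<open>The falling factorial is n! times a binomial coefficient, so the dependence on the order
  separates from that on the degree.\<close>

lemma dcoef_le:
  assumes "dcoef is \<alpha> \<noteq> 0"
  shows "dcoef is \<alpha> \<le> fact (length is) * 2 ^ mlen \<alpha>"
proof -
  let ?N = "mlen \<alpha>" and ?n = "length is"
  have *: "mlen (dexp is \<alpha>) = ?N - ?n" "?n \<le> ?N" "dcoef is \<alpha> * fact (?N - ?n) \<le> fact ?N"
    using dcoef_bound[of "is" \<alpha>] assms by (metis add_diff_cancel_right' le_add2)+
  have "(fact ?N :: real) = fact ?n * (?N choose ?n) * fact (?N - ?n)"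
    using binomial_fact[OF *(2), where 'a = real] by simp
  then have "dcoef is \<alpha> * fact (?N - ?n) \<le> fact ?n * (?N choose ?n) * fact (?N - ?n)" using *(3) by simp
  then have "dcoef is \<alpha> \<le> fact ?n * real (?N choose ?n)" by simp
  also have "\<dots> \<le> fact ?n * 2 ^ ?N"
  proof (rule mult_left_mono)
    show "real (?N choose ?n) \<le> 2 ^ ?N"
      using binomial_le_pow2[of ?N ?n] by (metis of_nat_le_iff of_nat_numeral of_nat_power)
  qed simp
  finally show ?thesis .
qed

text \<open>Convergence at one point with all offsets equal bounds the coefficients geometrically;
  on a smaller ball this outweighs the factor 2^|\<alpha>| of \<open>dcoef_le\<close>, for
  derivatives of every order at once.\<close>

lemma power_series_derivs:
  fixes f :: "real^'p::finite \<Rightarrow> 'f::banach"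
  assumes r: "r > 0"
    and f: "\<And>y. y \<in> ball x r \<Longrightarrow> ((\<lambda>\<alpha>. mono_fun \<alpha> (y - x) *\<^sub>R c \<alpha>) has_sum f y) UNIV"
  shows "\<exists>t>0. \<exists>A>0. \<exists>B>0. \<exists>F. derivs_on (ball x t) F \<and> (\<forall>y\<in>ball x t. f y = F [] y) \<and>
    (\<forall>y\<in>ball x t. \<forall>is. norm (F is y) \<le> A * B ^ length is * fact (length is))"
proof -
  \<comment> \<open>Division by the dimension keeps the point with all offsets equal to
    \<open>\<rho>\<close> inside the ball, by the l1 bound on the norm.\<close>
  define \<rho> where "\<rho> = r / (2 * CARD('p))"
  have \<rho>: "\<rho> > 0" using r by (simp add: \<rho>_def)
  have \<rho>r: "\<rho> \<le> r / 2" unfolding \<rho>_def using r by (intro divide_left_mono) auto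
  define u :: "real^'p" where "u = (\<chi> i. \<rho>)"
  have "norm u \<le> (\<Sum>i\<in>(UNIV :: 'p set). \<bar>u $ i\<bar>)" by (rule norm_le_l1_cart)
  also have "\<dots> = r / 2" using \<rho> r by (simp add: u_def \<rho>_def)
  finally have "x + u \<in> ball x r" using r by (simp add: dist_norm)
  from has_sum_imp_bounded[OF f[OF this]] obtain K where
    K: "K > 0" "\<And>\<alpha>. norm (mono_fun \<alpha> u *\<^sub>R c \<alpha>) \<le> K" by auto
  have Kc: "\<rho> ^ mlen \<alpha> * norm (c \<alpha>) \<le> K" for \<alpha>
  proof -
    have "mono_fun \<alpha> u = \<rho> ^ mlen \<alpha>" by (simp add: mono_fun_def u_def mlen_def power_sum)
    then show ?thesis using K(2)[of \<alpha>] \<rho> by simp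
  qed
  \<comment> \<open>Of the factor 4, one factor 2 absorbs 2^|\<alpha>| and the other leaves the
    summable (1/2)^|\<alpha>|.\<close>
  define t where "t = \<rho> / 4"
  have t: "t > 0" "t < r" using \<rho> \<rho>r r by (auto simp: t_def)
  have bound: "norm ((dcoef is \<alpha> * mono_fun (dexp is \<alpha>) (y - x)) *\<^sub>R c \<alpha>)
      \<le> K * (1 / t) ^ length is * fact (length is) * (1 / 2) ^ mlen \<alpha>" if "y \<in> ball x t" for y \<alpha> "is"
  proof (cases "dcoef is \<alpha> = 0")
    case True
    then show ?thesis using K t by simp
  next
    case False
    let ?N = "mlen \<alpha>" and ?n = "length is"
    have N: "mlen (dexp is \<alpha>) + ?n = ?N" using dcoef_bound[of "is" \<alpha>] False by auto
    have "\<bar>(y - x) $ i\<bar> \<le> t" for i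
      using component_le_norm_cart[of "y - x" i] that by (simp add: dist_norm norm_minus_commute)
    then have "\<bar>mono_fun (dexp is \<alpha>) (y - x)\<bar> \<le> t ^ mlen (dexp is \<alpha>)"
      using t by (intro abs_mono_fun_le) auto
    then have "norm ((dcoef is \<alpha> * mono_fun (dexp is \<alpha>) (y - x)) *\<^sub>R c \<alpha>)
        \<le> (fact ?n * 2 ^ ?N) * t ^ mlen (dexp is \<alpha>) * norm (c \<alpha>)"
      using dcoef_le[OF False] dcoef_nonneg[of "is" \<alpha>] t
      by (auto simp: abs_mult intro!: mult_right_mono mult_mono)
    also have "\<dots> = (1 / t) ^ ?n * fact ?n * (1 / 2) ^ ?N * (\<rho> ^ ?N * norm (c \<alpha>))"
    proof -
      have "t ^ mlen (dexp is \<alpha>) = t ^ ?N * (1 / t) ^ ?n"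
        using t unfolding N[symmetric] by (simp add: power_add power_one_over)
      moreover have "2 ^ ?N * t ^ ?N = (1 / 2) ^ ?N * \<rho> ^ ?N"
        unfolding power_mult_distrib[symmetric] t_def by simp
      ultimately show ?thesis by (simp add: mult_ac)
    qed
    also have "\<dots> \<le> (1 / t) ^ ?n * fact ?n * (1 / 2) ^ ?N * K"
      using t Kc by (intro mult_left_mono) auto
    finally show ?thesis by (simp add: mult_ac)
  qed
  obtain e :: "nat \<Rightarrow> ('p \<Rightarrow> nat)" where e: "bij_betw e UNIV UNIV" by (rule enumerate_multi_indices)
  have sum: "summable (\<lambda>k. (1 / 2 :: real) ^ mlen (e k))"
    using iffD2[OF summable_on_reindex_bij_betw[OF e] summable_on_half_power_mlen]
    by (rule summable_on_imp_summable)
  define G where "G k is y = (dcoef is (e k) * mono_fun (dexp is (e k)) (y - x)) *\<^sub>R c (e k)" for k "is" y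
  define b where "b is k = K * (1 / t) ^ length is * fact (length is) * (1 / 2) ^ mlen (e k)" for "is" :: "'p list" and k
  have b: "norm (G k is y) \<le> b is k" if "y \<in> ball x t" for k "is" y
    unfolding G_def b_def using bound[OF that] .
  have sb: "summable (b is)" for "is" unfolding b_def by (intro summable_mult sum)
  define F where "F is y = (\<Sum>k. G k is y)" for "is" y
  have "derivs_on (ball x t) F"
    unfolding F_def
  proof (rule derivs_on_suminf)
    show "derivs_on (ball x t) (G k)" for k
      using derivs_on_scaleR_const[OF mono_fun_derivs_on[of "e k" x], of "c (e k)"]
      unfolding G_def derivs_on_def by blast
  qed (use b sb in auto)
  moreover have "f y = F [] y" if "y \<in> ball x t" for y
  proof -
    have "((\<lambda>k. G k [] y) has_sum f y) UNIV"
      using has_sum_reindex_bij_betw[OF e, of "\<lambda>\<alpha>. mono_fun \<alpha> (y - x) *\<^sub>R c \<alpha>"] f[of y] that t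
      by (simp add: G_def)
    then show ?thesis unfolding F_def by (intro sums_unique has_sum_imp_sums)
  qed
  moreover define S where "S = 1 + (\<Sum>k. (1 / 2 :: real) ^ mlen (e k))"
  have S: "S > 0" unfolding S_def using suminf_nonneg[OF sum] by simp
  have "norm (F is y) \<le> (K * S) * (1 / t) ^ length is * fact (length is)" if "y \<in> ball x t" for "is" y
  proof -
    have "norm (F is y) \<le> (\<Sum>k. b is k)"
      unfolding F_def using b[OF that] sb by (intro norm_suminf_le) auto
    also have "\<dots> = K * (1 / t) ^ length is * fact (length is) * (S - 1)"
      unfolding b_def S_def by (subst suminf_mult[OF sum]) simp
    also have "\<dots> \<le> K * (1 / t) ^ length is * fact (length is) * S"
      using K t by (intro mult_left_mono) auto
    finally show ?thesis by (simp add: mult_ac)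
  qed
  ultimately have F: "derivs_on (ball x t) F \<and> (\<forall>y\<in>ball x t. f y = F [] y) \<and>
    (\<forall>y\<in>ball x t. \<forall>is. norm (F is y) \<le> (K * S) * (1 / t) ^ length is * fact (length is))" by blast
  have KS: "K * S > 0" and t': "1 / t > 0" using K S t by auto
  show ?thesis
    by (rule exI[of _ t], rule conjI[OF t(1)], rule exI[of _ "K * S"], rule conjI[OF KS],
        rule exI[of _ "1 / t"], rule conjI[OF t'], rule exI[of _ F], rule F)
qed

lemma dc_bounds_subset: "dc_bounds M V f \<Longrightarrow> W \<subseteq> V \<Longrightarrow> dc_bounds M W f"
  unfolding dc_bounds_def by blast

text \<open>As all weights are at least 1, the factorial bounds of a power series are already
  Denjoy-Carleman bounds.\<close>

lemma real_analytic_on_imp_dc_open: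
  fixes f :: "real^'p::finite \<Rightarrow> 'f::banach"
  assumes U: "open U" and f: "real_analytic_on U f" and M: "\<And>n. M n \<ge> 1"
  shows "dc_open M U f"
proof -
  have *: "\<exists>V. open V \<and> x \<in> V \<and> V \<subseteq> U \<and> dc_bounds M V f \<and> smooth_on V f" if x: "x \<in> U" for x
  proof -
    have "\<exists>c. \<exists>r>0. \<forall>y\<in>ball x r. ((\<lambda>\<alpha>. mono_fun \<alpha> (y - x) *\<^sub>R c \<alpha>) has_sum f y) UNIV"
      using f x unfolding real_analytic_on_def mono_fun_def by (simp add: vector_minus_component)
    then obtain c r where "r > 0"
      and "\<And>y. y \<in> ball x r \<Longrightarrow> ((\<lambda>\<alpha>. mono_fun \<alpha> (y - x) *\<^sub>R c \<alpha>) has_sum f y) UNIV"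
      by blast
    from power_series_derivs[OF this] obtain t A B F where t: "t > 0" "A > 0" "B > 0"
      and F: "derivs_on (ball x t) F" "\<And>y. y \<in> ball x t \<Longrightarrow> f y = F [] y"
      and b: "\<And>y is. y \<in> ball x t \<Longrightarrow> norm (F is y) \<le> A * B ^ length is * fact (length is)" by metis
    have "smooth_on (ball x t) f" by (rule derivs_on_smooth_on[OF F(1) open_ball F(2)])
    moreover have "dc_bounds M (ball x t) f"
    proof (rule dc_boundsI[OF t(2,3)])
      fix "is" y assume y: "y \<in> ball x t"
      have "norm (foldr partial is f y) \<le> A * B ^ length is * fact (length is) * 1"
        using b[OF y] derivs_on_foldr_partial[OF F(1) open_ball F(2) y] by simp
      also have "\<dots> \<le> A * B ^ length is * fact (length is) * M (length is)"
        using M t by (intro mult_left_mono) auto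
      finally show "norm (foldr partial is f y) \<le> A * B ^ length is * fact (length is) * M (length is)" .
    qed
    moreover from this have "dc_bounds M (ball x t \<inter> U) f" by (rule dc_bounds_subset) blast
    ultimately show ?thesis using x U t
      by (intro exI[of _ "ball x t \<inter> U"]) (auto simp: smooth_on_def)
  qed
  have "foldr partial is f differentiable (at x)" if "x \<in> U" for "is" x
    using *[OF that] unfolding smooth_on_def by blast
  moreover have "\<exists>V. open V \<and> x \<in> V \<and> V \<subseteq> U \<and> dc_bounds M V f" if "x \<in> U" for x
    using *[OF that] by blast
  ultimately show ?thesis unfolding dc_open_def smooth_on_def by simp
qed

section \<open>Taylor expansion under factorial bounds\<close>

lemma taylor_sums:
  fixes G :: "nat \<Rightarrow> real \<Rightarrow> 'f::banach"
  assumes G: "\<And>n t. t \<in> {0..1} \<Longrightarrow> (G n has_vector_derivative G (Suc n) t) (at t within {0..1})"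
    and b: "\<And>n t. t \<in> {0..1} \<Longrightarrow> norm (G n t) \<le> A * q ^ n * fact n"
    and q: "0 \<le> q" "q < 1"
  shows "(\<lambda>n. (1 / fact n) *\<^sub>R G n 0) sums G 0 1"
proof -
  \<comment> \<open>In the integral remainder the factorials cancel up to the factor n + 1, which
    the power of q < 1 still beats.\<close>
  have rem: "norm (G 0 1 - (\<Sum>i<Suc n. (1 / fact i) *\<^sub>R G i 0)) \<le> A * (real (Suc n) * q ^ Suc n)" for n
  proof -
    have "((\<lambda>x. ((1 - x) ^ (Suc n - 1) / fact (Suc n - 1)) *\<^sub>R G (Suc n) x) has_integral
        G 0 1 - (\<Sum>i<Suc n. ((1 - 0) ^ i / fact i) *\<^sub>R G i 0)) {0..1}"
      by (rule Taylor_has_integral) (use G in auto)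
    then have I: "((\<lambda>x. ((1 - x) ^ n / fact n) *\<^sub>R G (Suc n) x) has_integral
        G 0 1 - (\<Sum>i<Suc n. (1 / fact i) *\<^sub>R G i 0)) {0..1}" by simp
    have A: "0 \<le> A" using order_trans[OF norm_ge_zero b[of 0 0]] by simp
    have "norm (G 0 1 - (\<Sum>i<Suc n. (1 / fact i) *\<^sub>R G i 0))
        \<le> (A * (real (Suc n) * q ^ Suc n)) * measure lborel {0..1 :: real}"
    proof (rule has_integral_bound_real[OF _ finite.emptyI I])
      show "0 \<le> A * (real (Suc n) * q ^ Suc n)" using A q by simp
      fix x :: real assume "x \<in> {0..1} - {}"
      then have x: "x \<in> {0..1}" by simp
      have "norm (((1 - x) ^ n / fact n) *\<^sub>R G (Suc n) x) \<le> (1 / fact n) * (A * q ^ Suc n * fact (Suc n))"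
        unfolding norm_scaleR
        using x b[OF x, of "Suc n"] A q
        by (intro mult_mono) (auto simp: power_le_one divide_right_mono)
      also have "\<dots> = A * (real (Suc n) * q ^ Suc n)" by simp
      finally show "norm (((1 - x) ^ n / fact n) *\<^sub>R G (Suc n) x) \<le> A * (real (Suc n) * q ^ Suc n)" .
    qed
    then show ?thesis by simp
  qed
  have "(\<lambda>n. A * (real n * q ^ n)) \<longlonglongrightarrow> A * 0"
    by (intro tendsto_mult_left powser_times_n_limit_0) (use q in auto)
  then have "(\<lambda>n. A * (real (Suc n) * q ^ Suc n)) \<longlonglongrightarrow> 0" using LIMSEQ_Suc by fastforce
  then have "(\<lambda>n. G 0 1 - (\<Sum>i<Suc n. (1 / fact i) *\<^sub>R G i 0)) \<longlonglongrightarrow> 0"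
    by (rule Lim_null_comparison[rotated]) (use rem in auto)
  from tendsto_diff[OF tendsto_const[of "G 0 1"] this]
  have "(\<lambda>n. \<Sum>i<Suc n. (1 / fact i) *\<^sub>R G i 0) \<longlonglongrightarrow> G 0 1"
    by (simp del: sum.lessThan_Suc)
  then show ?thesis unfolding sums_def by (rule LIMSEQ_imp_Suc)
qed

lemma fact_add_le: "(fact (a + b) :: real) \<le> 2 ^ (a + b) * fact a * fact b"
proof -
  have "(fact (a + b) :: real) = real ((a + b) choose a) * fact a * fact b"
    using binomial_fact[of a "a + b", where 'a = real] by simp
  also have "real ((a + b) choose a) \<le> 2 ^ (a + b)"
    using binomial_le_pow2[of "a + b" a] by (metis of_nat_le_iff of_nat_numeral of_nat_power)
  finally show ?thesis by (simp add: mult_right_mono)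
qed

text \<open>Bounds the multinomial coefficient |\<alpha>|! / \<alpha>! geometrically, to set the
  |\<alpha>|! of the derivative bounds against the \<alpha>! of the Taylor coefficients.\<close>

lemma fact_sum_le:
  "finite S \<Longrightarrow> (fact (sum \<alpha> S) :: real) \<le> (2 ^ card S) ^ sum \<alpha> S * (\<Prod>i\<in>S. fact (\<alpha> i))"
proof (induction S rule: finite_induct)
  case (insert i S)
  let ?s = "sum \<alpha> S"
  have "(fact (\<alpha> i + ?s) :: real) \<le> 2 ^ (\<alpha> i + ?s) * fact (\<alpha> i) * fact ?s" by (rule fact_add_le)
  also have "\<dots> \<le> 2 ^ (\<alpha> i + ?s) * fact (\<alpha> i) * ((2 ^ card S) ^ ?s * (\<Prod>i\<in>S. fact (\<alpha> i)))"
    using insert by (intro mult_left_mono) auto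
  also have "\<dots> \<le> 2 ^ (\<alpha> i + ?s) * fact (\<alpha> i) * ((2 ^ card S) ^ (\<alpha> i + ?s) * (\<Prod>i\<in>S. fact (\<alpha> i)))"
    by (intro mult_left_mono mult_right_mono power_increasing) (auto simp: prod_nonneg)
  also have "\<dots> = (2 ^ Suc (card S)) ^ (\<alpha> i + ?s) * (fact (\<alpha> i) * (\<Prod>i\<in>S. fact (\<alpha> i)))"
    by (simp add: power_mult_distrib mult_ac)
  finally show ?case using insert by simp
qed simp

text \<open>The offset before the coordinates in \<open>S\<close> have been moved; it is 0 for full
  \<open>S\<close> and \<open>h\<close> for empty \<open>S\<close>.\<close>

definition drop_coords :: "'p set \<Rightarrow> real^'p \<Rightarrow> real^'p::finite" where
  "drop_coords S h = (\<chi> i. if i \<in> S then 0 else h $ i)"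

lemma norm_drop_coords_le: "norm (drop_coords S h + t *\<^sub>R axis c 1) \<le> norm h" if "c \<in> S" "\<bar>t\<bar> \<le> \<bar>h $ c\<bar>"
proof (rule norm_le_componentwise_cart)
  show "norm ((drop_coords S h + t *\<^sub>R axis c 1) $ i) \<le> norm (h $ i)" for i
    using that by (auto simp: drop_coords_def axis_def)
qed

lemma mindex_cong: "(\<And>i. i \<in> set cs \<Longrightarrow> \<alpha> i = \<beta> i) \<Longrightarrow> mindex \<alpha> cs = mindex \<beta> cs"
  by (simp add: mindex_def cong: map_cong)

lemma mindex_append_zero: "(\<And>i. i \<in> set ds \<Longrightarrow> \<alpha> i = 0) \<Longrightarrow> mindex \<alpha> (ds @ cs) = mindex \<alpha> cs"
  by (induction ds) (auto simp: mindex_def)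

text \<open>
  Expanding in one coordinate at a time, the last one of the enumeration first, only produces
  derivatives whose order is the one in \<open>mderiv\<close>, so no symmetry of mixed partials is needed.
\<close>

lemma taylor_coords:
  fixes F :: "'p::finite list \<Rightarrow> real^'p \<Rightarrow> 'f::banach"
  assumes F: "derivs_on (ball x r) F"
    and bound: "\<And>\<alpha> y. y \<in> ball x r \<Longrightarrow> norm (F (mindex \<alpha> coords) y) \<le> A * B ^ mlen \<alpha> * fact (mlen \<alpha>)"
    and pos: "A > 0" "B > 0" "\<eta> \<ge> 0"
    and \<eta>: "2 ^ CARD('p) * B * \<eta> \<le> 1 / 2"
    and h: "norm h < r" "\<And>i. \<bar>h $ i\<bar> \<le> \<eta>"
    and cs: "coords = ds @ cs"
  shows "((\<lambda>\<alpha>. (\<Prod>i\<in>set cs. (h $ i) ^ \<alpha> i / fact (\<alpha> i)) *\<^sub>R F (mindex \<alpha> cs) (x + drop_coords (set cs) h))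
    has_sum F [] (x + h)) {\<alpha>. \<forall>i. i \<notin> set cs \<longrightarrow> \<alpha> i = 0}"
  using cs
proof (induction cs arbitrary: ds)
  case Nil
  have "{\<alpha> :: 'p \<Rightarrow> nat. \<forall>i. i \<notin> set [] \<longrightarrow> \<alpha> i = 0} = {\<lambda>_. 0}" by auto
  moreover have "drop_coords (set []) h = h" by (simp add: drop_coords_def vec_eq_iff)
  ultimately show ?case using has_sum_finite[of "{\<lambda>_. 0}" "\<lambda>\<alpha>. F [] (x + h)"] by (simp add: mindex_def)
next
  case (Cons c cs)
  have dist: "distinct (c # cs)" "distinct (ds @ c # cs)" "set (ds @ c # cs) = UNIV"
    using coords[where 'p = 'p] unfolding Cons.prems by auto
  \<comment> \<open>A multi-index supported on \<open>c # cs\<close> has the same list with respect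
    to all coordinates, so the hypothesis on full lists is available at every stage.\<close>
  have bd: "norm (F (mindex \<alpha> (c # cs)) y) \<le> A * B ^ mlen \<alpha> * fact (mlen \<alpha>)"
    if "\<forall>i. i \<notin> set (c # cs) \<longrightarrow> \<alpha> i = 0" "y \<in> ball x r" for \<alpha> y
  proof -
    have "mindex \<alpha> coords = mindex \<alpha> (c # cs)"
      unfolding Cons.prems using that dist by (intro mindex_append_zero) auto
    then show ?thesis using bound[OF that(2), of \<alpha>] by simp
  qed
  let ?S = "{\<alpha> :: 'p \<Rightarrow> nat. \<forall>i. i \<notin> set cs \<longrightarrow> \<alpha> i = 0}"
  let ?S' = "{\<alpha> :: 'p \<Rightarrow> nat. \<forall>i. i \<notin> set (c # cs) \<longrightarrow> \<alpha> i = 0}"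
  let ?z = "x + drop_coords (set (c # cs)) h"
  define T where "T \<alpha> = (\<Prod>i\<in>set (c # cs). (h $ i) ^ \<alpha> i / fact (\<alpha> i)) *\<^sub>R F (mindex \<alpha> (c # cs)) ?z" for \<alpha>
  define g where "g \<alpha> = (\<Prod>i\<in>set cs. (h $ i) ^ \<alpha> i / fact (\<alpha> i)) *\<^sub>R F (mindex \<alpha> cs) (x + drop_coords (set cs) h)" for \<alpha>
  have line: "?z + (t * h $ c) *\<^sub>R axis c 1 \<in> ball x r" if "t \<in> {0..1}" for t
  proof -
    have "\<bar>t * h $ c\<bar> \<le> \<bar>h $ c\<bar>" using that by (simp add: abs_mult mult_left_le_one_le)
    then have "norm (drop_coords (set (c # cs)) h + (t * h $ c) *\<^sub>R axis c 1) < r"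
      using norm_drop_coords_le[of c "set (c # cs)" "t * h $ c" h] h(1) by auto
    then show ?thesis
      by (metis add.assoc add_diff_cancel_left' dist_commute dist_norm mem_ball)
  qed
  have upd: "mindex (\<alpha>(c := a)) (c # cs) = replicate a c @ mindex \<alpha> cs" for \<alpha> a
  proof -
    have "mindex (\<alpha>(c := a)) cs = mindex \<alpha> cs" using dist by (intro mindex_cong) auto
    then show ?thesis by (simp add: mindex_def)
  qed
  have T_upd: "T (\<alpha>(c := a)) = (\<Prod>i\<in>set cs. (h $ i) ^ \<alpha> i / fact (\<alpha> i)) *\<^sub>R
      ((h $ c) ^ a / fact a) *\<^sub>R F (replicate a c @ mindex \<alpha> cs) ?z" for \<alpha> a
  proof -
    have "(\<Prod>i\<in>set cs. (h $ i) ^ (\<alpha>(c := a)) i / fact ((\<alpha>(c := a)) i)) = (\<Prod>i\<in>set cs. (h $ i) ^ \<alpha> i / fact (\<alpha> i))"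
      using dist by (intro prod.cong) auto
    then show ?thesis unfolding T_def upd using dist by simp
  qed
  have inner: "((\<lambda>a. T (\<alpha>(c := a))) has_sum g \<alpha>) UNIV" if \<alpha>: "\<alpha> \<in> ?S" for \<alpha>
  proof -
    \<comment> \<open>\<open>G a t\<close> is the a-th derivative in t along the segment that moves
      only the coordinate \<open>c\<close>, from its value at \<open>x\<close> to its final
      value.\<close>
    define G where "G a t = (h $ c) ^ a *\<^sub>R F (replicate a c @ mindex \<alpha> cs) (?z + (t * h $ c) *\<^sub>R axis c 1)" for a t
    define K where "K = A * (2 * B) ^ mlen \<alpha> * fact (mlen \<alpha>)"
    define q where "q = 2 * B * \<eta>"
    \<comment> \<open>\<open>2 * B * \<eta>\<close> is the ratio left after
      \<open>fact_add_le\<close> splits (|\<alpha>| + a)!; the dimension is at least 1, so it is at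
      most the quantity bounded by 1/2.\<close>
    have le: "2 * (B * \<eta>) \<le> 2 ^ CARD('p) * (B * \<eta>)"
      using pos power_increasing[of 1 "CARD('p)" "2 :: real"] by (intro mult_right_mono) auto
    have "q \<le> 1 / 2" using le \<eta> unfolding q_def mult.assoc by linarith
    then have q: "0 \<le> q" "q \<le> 1 / 2" using pos by (auto simp: q_def)
    have Gb: "norm (G a t) \<le> K * q ^ a * fact a" if t: "t \<in> {0..1}" for a t
    proof -
      have c0: "\<alpha> c = 0" using \<alpha> dist by auto
      have len: "mlen (\<alpha>(c := a)) = mlen \<alpha> + a" using mlen_fun_upd[of \<alpha> c a] c0 by simp
      have "norm (F (replicate a c @ mindex \<alpha> cs) (?z + (t * h $ c) *\<^sub>R axis c 1))
          \<le> A * B ^ (mlen \<alpha> + a) * fact (mlen \<alpha> + a)"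
        using bd[of "\<alpha>(c := a)" "?z + (t * h $ c) *\<^sub>R axis c 1"] line[OF t] \<alpha> unfolding upd len by auto
      also have "\<dots> \<le> A * B ^ (mlen \<alpha> + a) * (2 ^ (mlen \<alpha> + a) * fact (mlen \<alpha>) * fact a)"
        using pos by (intro mult_left_mono fact_add_le) auto
      also have "\<dots> = K * (2 * B) ^ a * fact a"
        unfolding K_def by (simp add: power_add power_mult_distrib mult_ac)
      finally have "norm (G a t) \<le> \<bar>h $ c\<bar> ^ a * (K * (2 * B) ^ a * fact a)"
        unfolding G_def norm_scaleR real_norm_def power_abs by (rule mult_left_mono) simp
      also have "\<dots> \<le> \<eta> ^ a * (K * (2 * B) ^ a * fact a)"
        using h(2)[of c] pos by (intro mult_right_mono power_mono) (auto simp: K_def)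
      finally show ?thesis by (simp add: q_def power_mult_distrib mult_ac)
    qed
    have "(\<lambda>a. (1 / fact a) *\<^sub>R G a 0) sums G 0 1"
    proof (rule taylor_sums[OF _ Gb])
      show "(G a has_vector_derivative G (Suc a) t) (at t within {0..1})" if t: "t \<in> {0..1}" for a t
      proof -
        let ?js = "replicate a c @ mindex \<alpha> cs"
        have D: "((\<lambda>t. F ?js (?z + t *\<^sub>R axis c 1)) has_vector_derivative
            F (c # ?js) (?z + (t * h $ c) *\<^sub>R axis c 1)) (at (t * h $ c))"
          by (rule derivs_on_line[OF F line[OF t]])
        have "((\<lambda>t. t * h $ c) has_real_derivative h $ c) (at t)"
          by (auto intro!: derivative_eq_intros)
        from vector_diff_chain_at[OF this[unfolded has_real_derivative_iff_has_vector_derivative] D]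
        have "((\<lambda>t. F ?js (?z + (t * h $ c) *\<^sub>R axis c 1)) has_vector_derivative
            h $ c *\<^sub>R F (c # ?js) (?z + (t * h $ c) *\<^sub>R axis c 1)) (at t)" unfolding o_def .
        from has_vector_derivative_scaleR[OF DERIV_const this, of "(h $ c) ^ a"]
        have "(G a has_vector_derivative G (Suc a) t) (at t)"
          unfolding G_def by (simp add: mult_ac)
        then show ?thesis by (rule has_vector_derivative_at_within)
      qed
    qed (use q in auto)
    moreover have "summable (\<lambda>a. norm ((1 / fact a) *\<^sub>R G a 0))"
    proof (rule summable_comparison_test')
      show "summable (\<lambda>a. K * q ^ a)" using q by (intro summable_mult summable_geometric) auto
      show "norm (norm ((1 / fact a) *\<^sub>R G a 0)) \<le> K * q ^ a" if "a \<ge> 0" for a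
        using Gb[of 0 a] by (simp add: field_simps)
    qed
    ultimately have "((\<lambda>a. (1 / fact a) *\<^sub>R G a 0) has_sum G 0 1) UNIV"
      by (intro norm_summable_imp_has_sum)
    moreover have "G 0 1 = F (mindex \<alpha> cs) (x + drop_coords (set cs) h)"
    proof -
      have "drop_coords (set (c # cs)) h + (h $ c) *\<^sub>R axis c 1 = drop_coords (set cs) h"
        using dist by (auto simp: drop_coords_def axis_def vec_eq_iff)
      then show ?thesis by (simp add: G_def add.assoc)
    qed
    ultimately have "((\<lambda>a. (\<Prod>i\<in>set cs. (h $ i) ^ \<alpha> i / fact (\<alpha> i)) *\<^sub>R (1 / fact a) *\<^sub>R G a 0) has_sum g \<alpha>) UNIV"
      unfolding g_def by (intro has_sum_scaleR) simp
    then show ?thesis unfolding T_upd G_def by simp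
  qed
  \<comment> \<open>Absolute summability over the larger index set allows the inner sums over a and
    the outer sum over \<alpha> to be merged.\<close>
  have Tb: "norm (T \<alpha>) \<le> A * (1 / 2) ^ mlen \<alpha>" if \<alpha>: "\<alpha> \<in> ?S'" for \<alpha>
  proof -
    let ?n = "mlen \<alpha>" and ?f = "\<Prod>i\<in>set (c # cs). fact (\<alpha> i) :: real"
    have n: "(\<Sum>i\<in>set (c # cs). \<alpha> i) = ?n"
      unfolding mlen_def using \<alpha> by (intro sum.mono_neutral_left) auto
    have f: "?f > 0" by (intro prod_pos) auto
    have "\<bar>\<Prod>i\<in>set (c # cs). (h $ i) ^ \<alpha> i / fact (\<alpha> i)\<bar> = (\<Prod>i\<in>set (c # cs). \<bar>h $ i\<bar> ^ \<alpha> i) / ?f"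
      by (simp only: abs_prod prod_dividef[symmetric]) (simp add: power_abs)
    also have "\<dots> \<le> (\<Prod>i\<in>set (c # cs). \<eta> ^ \<alpha> i) / ?f"
      using h(2) f by (intro divide_right_mono prod_mono conjI power_mono) auto
    also have "\<dots> = \<eta> ^ ?n / ?f" by (simp only: n[symmetric] power_sum)
    finally have 1: "\<bar>\<Prod>i\<in>set (c # cs). (h $ i) ^ \<alpha> i / fact (\<alpha> i)\<bar> \<le> \<eta> ^ ?n / ?f" .
    have "fact ?n \<le> (2 ^ card (set (c # cs))) ^ ?n * ?f"
      using fact_sum_le[of "set (c # cs)" \<alpha>] unfolding n by simp
    also have "\<dots> \<le> (2 ^ CARD('p)) ^ ?n * ?f"
      using f by (intro mult_right_mono power_mono power_increasing card_mono) auto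
    finally have 2: "fact ?n \<le> (2 ^ CARD('p)) ^ ?n * ?f" .
    have "norm (F (mindex \<alpha> (c # cs)) ?z) \<le> A * B ^ ?n * fact ?n"
      using bd[of \<alpha> ?z] \<alpha> line[of 0] by simp
    also have "\<dots> \<le> A * B ^ ?n * ((2 ^ CARD('p)) ^ ?n * ?f)"
      using 2 pos by (intro mult_left_mono) auto
    finally have "norm (T \<alpha>) \<le> (\<eta> ^ ?n / ?f) * (A * B ^ ?n * ((2 ^ CARD('p)) ^ ?n * ?f))"
      unfolding T_def norm_scaleR real_norm_def using 1 by (intro mult_mono) auto
    also have "\<dots> = A * (2 ^ CARD('p) * B * \<eta>) ^ ?n" using f by (simp add: power_mult_distrib)
    also have "\<dots> \<le> A * (1 / 2) ^ ?n" using \<eta> pos by (intro mult_left_mono power_mono) auto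
    finally show ?thesis .
  qed
  have bij: "bij_betw (\<lambda>(\<alpha>, a). \<alpha>(c := a)) (?S \<times> UNIV) ?S'"
  proof (rule bij_betw_byWitness[where f' = "\<lambda>\<alpha>. (\<alpha>(c := 0), \<alpha> c)"])
    show "\<forall>p\<in>?S \<times> UNIV. (\<lambda>\<alpha>. (\<alpha>(c := 0), \<alpha> c)) ((\<lambda>(\<alpha>, a). \<alpha>(c := a)) p) = p"
      using dist by (auto simp: fun_eq_iff)
  qed (auto split: if_splits)
  have "(\<lambda>\<alpha>. A * (1 / 2 :: real) ^ mlen \<alpha>) summable_on ?S'"
    by (rule summable_on_subset_banach[OF summable_on_cmult_right[OF summable_on_half_power_mlen]]) simp
  then have "(\<lambda>\<alpha>. norm (T \<alpha>)) summable_on ?S'" by (rule Infinite_Sum.abs_summable_on_comparison_test') (rule Tb)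
  then have "T summable_on ?S'" by (rule abs_summable_summable)
  then have "(\<lambda>p. T ((\<lambda>(\<alpha>, a). \<alpha>(c := a)) p)) summable_on (?S \<times> UNIV)"
    by (rule iffD2[OF summable_on_reindex_bij_betw[OF bij]])
  moreover have "(g has_sum F [] (x + h)) ?S" unfolding g_def by (rule Cons.IH[of "ds @ [c]"]) (simp add: Cons.prems)
  ultimately have "((\<lambda>p. T ((\<lambda>(\<alpha>, a). \<alpha>(c := a)) p)) has_sum F [] (x + h)) (?S \<times> UNIV)"
    by (intro has_sum_SigmaI[where g = g]) (use inner in auto)
  then have "(T has_sum F [] (x + h)) ?S'" by (rule iffD1[OF has_sum_reindex_bij_betw[OF bij]])
  then show ?case unfolding T_def .
qed

text \<open>Weights below C^n only change B into B C, so the derivatives obey factorial bounds and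
  the Taylor series converges to \<open>f\<close>.\<close>

lemma dc_open_imp_real_analytic_on:
  fixes f :: "real^'p::finite \<Rightarrow> 'f::banach"
  assumes f: "dc_open M U f" and M: "\<And>n. M n \<le> C ^ n" and C: "C > 0"
  shows "real_analytic_on U f"
  unfolding real_analytic_on_def
proof
  fix x assume x: "x \<in> U"
  obtain V where V: "open V" "x \<in> V" "V \<subseteq> U" "dc_bounds M V f"
    using f x unfolding dc_open_def by blast
  obtain A B where AB: "A > 0" "B > 0"
    and b: "\<And>\<alpha> y. y \<in> V \<Longrightarrow> norm (mderiv \<alpha> f y) \<le> A * B ^ mlen \<alpha> * fact (mlen \<alpha>) * M (mlen \<alpha>)"
    using V(4) unfolding dc_bounds_def by blast
  obtain r where r: "r > 0" "ball x r \<subseteq> V" using V(1,2) openE by blast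
  define F where "F = (\<lambda>is. foldr partial is f)"
  have F: "derivs_on (ball x r) F"
    unfolding F_def
    by (rule smooth_on_derivs_on) (use f r V(3) in \<open>auto simp: dc_open_def smooth_on_def\<close>)
  have bound: "norm (F (mindex \<alpha> coords) y) \<le> A * (B * C) ^ mlen \<alpha> * fact (mlen \<alpha>)" if "y \<in> ball x r" for \<alpha> y
  proof -
    have "norm (mderiv \<alpha> f y) \<le> A * B ^ mlen \<alpha> * fact (mlen \<alpha>) * M (mlen \<alpha>)" using b that r by blast
    also have "\<dots> \<le> A * B ^ mlen \<alpha> * fact (mlen \<alpha>) * C ^ mlen \<alpha>"
      using AB M by (intro mult_left_mono) auto
    finally show ?thesis by (simp add: F_def mderiv_eq power_mult_distrib mult_ac)
  qed
  \<comment> \<open>The first entry keeps the offset inside the ball of radius r, the second is the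
    smallness that \<open>taylor_coords\<close> demands for the constant B C.\<close>
  define \<eta> where "\<eta> = min (r / 2) (1 / (2 * 2 ^ CARD('p) * (B * C)))"
  have \<eta>: "\<eta> > 0" "\<eta> < r" using r AB C by (auto simp: \<eta>_def)
  have "\<eta> \<le> 1 / (2 * 2 ^ CARD('p) * (B * C))" by (simp add: \<eta>_def)
  then have \<eta>': "2 ^ CARD('p) * (B * C) * \<eta> \<le> 1 / 2" using AB C by (simp add: field_simps)
  define c where "c \<alpha> = (1 / (\<Prod>i\<in>UNIV. fact (\<alpha> i))) *\<^sub>R mderiv \<alpha> f x" for \<alpha>
  have "((\<lambda>\<alpha>. (\<Prod>i\<in>UNIV. (y $ i - x $ i) ^ \<alpha> i) *\<^sub>R c \<alpha>) has_sum f y) UNIV" if y: "y \<in> ball x \<eta>" for y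
  proof -
    let ?h = "y - x"
    have n: "norm ?h < \<eta>" using y by (simp add: dist_norm norm_minus_commute)
    have h: "\<bar>?h $ i\<bar> \<le> \<eta>" for i using component_le_norm_cart[of ?h i] n by linarith
    have "((\<lambda>\<alpha>. (\<Prod>i\<in>set coords. (?h $ i) ^ \<alpha> i / fact (\<alpha> i)) *\<^sub>R F (mindex \<alpha> coords) (x + drop_coords (set coords) ?h))
      has_sum F [] (x + ?h)) {\<alpha>. \<forall>i. i \<notin> set coords \<longrightarrow> \<alpha> i = 0}"
      by (rule taylor_coords[OF F bound AB(1) _ _ \<eta>' _ h, where ds = "[]"]) (use \<eta> AB C n in auto)
    moreover have "drop_coords UNIV ?h = 0" by (simp add: drop_coords_def vec_eq_iff)
    moreover have "{\<alpha> :: 'p \<Rightarrow> nat. \<forall>i. i \<notin> set coords \<longrightarrow> \<alpha> i = 0} = UNIV" by (simp add: coords)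
    ultimately have "((\<lambda>\<alpha>. (\<Prod>i\<in>UNIV. (?h $ i) ^ \<alpha> i / fact (\<alpha> i)) *\<^sub>R mderiv \<alpha> f x) has_sum f y) UNIV"
      by (simp add: coords F_def mderiv_eq)
    then show ?thesis by (simp add: c_def prod_dividef)
  qed
  then show "\<exists>c. \<exists>r>0. \<forall>y\<in>ball x r. ((\<lambda>\<alpha>. (\<Prod>i\<in>UNIV. (y $ i - x $ i) ^ \<alpha> i) *\<^sub>R c \<alpha>) has_sum f y) UNIV"
    using \<eta>(1) by blast
qed

text \<open>Used in contrapositive form: if the class is not analytic, then for every C > 0 some
  weight exceeds C^n.\<close>

lemma is_analytic_classI:
  fixes M :: "nat \<Rightarrow> real"
  assumes "weight_seq M" "C > 0" "\<And>n. M n \<le> C ^ n"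
  shows "is_analytic_class M TYPE(real^'p::finite) TYPE('f::banach)"
proof -
  have "M n \<ge> 1" for n
    using assms(1) monoD[of M 0 n] unfolding weight_seq_def by auto
  then have "dc_open M U f \<longleftrightarrow> real_analytic_on U f" if "open U" for U and f :: "real^'p \<Rightarrow> 'f"
    using real_analytic_on_imp_dc_open[OF that] dc_open_imp_real_analytic_on[OF _ assms(3,2)] by blast
  then show ?thesis unfolding is_analytic_class_def by blast
qed

subsection \<open>Series of poles\<close>

lemma weight_seq_ge_one: "weight_seq M \<Longrightarrow> M n \<ge> 1"
  using monoD[of M 0 n] unfolding weight_seq_def by auto

text \<open>If all ratios stayed below 1 / d, then M n \<le> (1 / d)^n for all n. So some ratio
  reaches 1 / d, all later ones do by log-convexity, and M n d^n does not decrease from there on;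
  the finitely many earlier values are positive.\<close>

lemma weight_seq_power_bounded_below:
  assumes M: "weight_seq M" and unb: "\<And>C. C > 0 \<Longrightarrow> \<exists>n. M n > C ^ n" and d: "d > 0"
  shows "\<exists>L>0. \<forall>n. L \<le> M n * d ^ n"
proof -
  have pos: "M n > 0" for n using M by (simp add: weight_seq_def)
  have "\<exists>n0. M (Suc n0) / M n0 \<ge> 1 / d"
  proof (rule ccontr)
    assume "\<not> ?thesis"
    then have *: "M (Suc n) / M n < 1 / d" for n by (simp add: not_le)
    have "M n \<le> (1 / d) ^ n" for n
    proof (induction n)
      case 0
      then show ?case using M by (simp add: weight_seq_def)
    next
      case (Suc n)
      have "M (Suc n) = M (Suc n) / M n * M n" using pos[of n] by simp
      also have "\<dots> \<le> 1 / d * (1 / d) ^ n"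
        using *[of n] Suc pos[of n] d by (intro mult_mono) auto
      finally show ?case by simp
    qed
    then show False using unb[of "1 / d"] d by (meson divide_pos_pos less_le_not_le zero_less_one)
  qed
  then obtain n0 where n0: "M (Suc n0) / M n0 \<ge> 1 / d" ..
  have step: "M n0 * d ^ n0 \<le> M n * d ^ n" if "n \<ge> n0" for n
    using that
  proof (induction n rule: dec_induct)
    case (step n)
    have "M (Suc n0) / M n0 \<le> M (Suc n) / M n"
      using M step(1) unfolding weight_seq_def by (auto dest: monoD)
    then have "1 / d \<le> M (Suc n) / M n" using n0 by linarith
    then have "M n \<le> M (Suc n) * d" using d pos[of n] by (simp add: field_simps)
    then have "M n * d ^ n \<le> M (Suc n) * d * d ^ n" using d by (intro mult_right_mono) auto
    then show ?case using step by (simp add: mult_ac)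
  qed simp
  define L where "L = Min ((\<lambda>n. M n * d ^ n) ` {..n0})"
  have L: "L \<le> M n * d ^ n" if "n \<le> n0" for n unfolding L_def using that by (intro Min_le) auto
  have "L > 0" unfolding L_def using pos d by (subst Min_gr_iff) auto
  moreover have "L \<le> M n * d ^ n" for n
    using L[of n] L[of n0] step[of n] by linarith
  ultimately show ?thesis by blast
qed

text \<open>
  The first two estimates keep the \<open>k\<close>-th pole small globally for low orders and away from its
  centre for all orders, the last one makes its derivative of order \<open>2 * k\<close> at the centre large.
\<close>

lemma pole_parameters:
  assumes M: "weight_seq M" and unb: "\<And>C. C > 0 \<Longrightarrow> \<exists>n. M n > C ^ n" and d: "0 < d" "d \<le> 1"
  shows "\<exists>c e. c > 0 \<and> e > 0 \<and> (\<forall>n. n + 2 \<le> 2 * k + 1 \<longrightarrow> c / e ^ (n + 2) \<le> (1 / 2) ^ k)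
    \<and> (\<forall>n. c / d ^ (n + 2) \<le> (1 / 2) ^ k * M n)
    \<and> c / e ^ (2 * k + 2) = real k ^ (2 * k) * M (2 * k)"
proof -
  obtain L where L: "L > 0" "\<And>n. L \<le> M n * d ^ n"
    using weight_seq_power_bounded_below[OF M unb d(1)] by blast
  have L1: "L \<le> 1" using L(2)[of 0] M by (simp add: weight_seq_def)
  define R where "R = real k ^ (2 * k) * M (2 * k)"
  \<comment> \<open>For k = 0 this is 0^0 = 1.\<close>
  have "real k ^ (2 * k) \<ge> 1" by (cases "k = 0") auto
  then have R: "R \<ge> 1" unfolding R_def using weight_seq_ge_one[OF M, of "2 * k"] mult_mono[of 1 _ 1] by fastforce
  \<comment> \<open>Since L d^2 \<le> M n d^(n+2), every c \<le> \<open>\<eta>\<close> satisfies the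
    estimate at distance d for all n.\<close>
  define \<eta> where "\<eta> = (1 / 2) ^ k * L * d\<^sup>2"
  have d2: "d\<^sup>2 \<le> 1" "d\<^sup>2 > 0" using d by (auto simp: power_le_one)
  have Ld: "L * d\<^sup>2 \<le> 1" using mult_mono[OF L1 d2(1)] d2 by simp
  have \<eta>: "\<eta> > 0" "\<eta> \<le> (1 / 2) ^ k"
    using L d mult_left_mono[OF Ld, of "(1 / 2) ^ k"] by (auto simp: \<eta>_def mult.assoc)
  have \<eta>1: "\<eta> \<le> 1" using \<eta>(2) power_le_one[of "1 / 2 :: real" k] by linarith
  \<comment> \<open>With c = e^(2k+2) R = e^(2k+1) \<open>\<eta>\<close> and e \<le> 1, division by
    e^(2k+2) gives exactly R, while division by lower powers of e gives at most
    \<open>\<eta>\<close>.\<close>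
  define e where "e = \<eta> / R"
  have e: "e > 0" using \<eta> R by (simp add: e_def)
  have "e \<le> \<eta>" unfolding e_def using R \<eta> by (simp add: field_simps)
  then have e1: "e \<le> 1" using \<eta>1 by linarith
  define c where "c = e ^ (2 * k + 2) * R"
  have c: "c = e ^ (2 * k + 1) * \<eta>" using R unfolding c_def e_def by simp
  have "c > 0" using e R by (simp add: c_def)
  moreover have "c / e ^ (n + 2) \<le> (1 / 2) ^ k" if "n + 2 \<le> 2 * k + 1" for n
  proof -
    have "c / e ^ (n + 2) = e ^ (2 * k + 1 - (n + 2)) * \<eta>"
      unfolding c using e that by (simp only: power_diff) simp
    also have "\<dots> \<le> 1 * \<eta>" using e e1 \<eta> by (intro mult_right_mono power_le_one) auto
    finally show ?thesis using \<eta> by linarith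
  qed
  moreover have "c / d ^ (n + 2) \<le> (1 / 2) ^ k * M n" for n
  proof -
    have "c \<le> 1 * \<eta>" unfolding c using e e1 \<eta> by (intro mult_right_mono power_le_one) auto
    then have "c / d ^ (n + 2) \<le> \<eta> / d ^ (n + 2)" using d by (intro divide_right_mono) auto
    also have "\<dots> = (1 / 2) ^ k * (L / d ^ n)"
      using d by (simp add: \<eta>_def power_add power2_eq_square)
    also have "\<dots> \<le> (1 / 2) ^ k * M n"
      using L(2)[of n] d by (intro mult_left_mono) (auto simp: field_simps)
    finally show ?thesis .
  qed
  moreover have "c / e ^ (2 * k + 2) = R" using e by (simp add: c_def)
  ultimately show ?thesis using e unfolding R_def by blast
qed

text \<open>Separates the analysis from the geometry of the centres: all that remains of the latter
  are regions \<open>T k\<close> on which the k-th term obeys Denjoy-Carleman bounds with weight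
  (1/2)^k.\<close>

locale pole_series =
  fixes M :: "nat \<Rightarrow> real" and P :: "nat \<Rightarrow> real^'p::finite" and T :: "nat \<Rightarrow> (real^'p) set"
    and c d e :: "nat \<Rightarrow> real"
  assumes M_ge_one: "\<And>n. M n \<ge> 1"
    and T_away: "\<And>k x. x \<in> T k \<Longrightarrow> d k \<le> dist x (P k)"
    and pos: "\<And>k. c k > 0" "\<And>k. d k > 0" "\<And>k. e k > 0"
    and small: "\<And>k n. n + 2 \<le> 2 * k + 1 \<Longrightarrow> c k / e k ^ (n + 2) \<le> (1 / 2) ^ k"
    and small_T: "\<And>k n. c k / d k ^ (n + 2) \<le> (1 / 2) ^ k * M n"
    and large: "\<And>k. c k / e k ^ (2 * k + 2) = real k ^ (2 * k) * M (2 * k)"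
    and separated: "\<And>j k. j \<noteq> k \<Longrightarrow> P k \<in> T j"
begin

definition summand :: "nat \<Rightarrow> 'p list \<Rightarrow> real^'p \<Rightarrow> real" where
  "summand k is x = foldr partial is (\<lambda>x. 1 / pole (P k) (e k) x) x *\<^sub>R c k"

definition total :: "'p list \<Rightarrow> real^'p \<Rightarrow> real" where
  "total is x = (\<Sum>k. summand k is x)"

text \<open>\<open>r\<close> is left free for two uses: \<open>e k\<close>, a lower bound
  everywhere, and \<open>d k\<close>, a lower bound on \<open>T k\<close>.\<close>

lemma abs_summand_le:
  assumes "0 < r" "r \<le> sqrt (pole (P k) (e k) x)"
  shows "\<bar>summand k is x\<bar> \<le> 3 ^ length is * fact (length is) * (c k / r ^ (length is + 2))"
proof -
  have "\<bar>foldr partial is (\<lambda>x. 1 / pole (P k) (e k) x) x\<bar>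
      \<le> 3 ^ length is * fact (length is) / sqrt (pole (P k) (e k) x) ^ (length is + 2)"
    using pos(3)[of k] by (intro inverse_pole_bound) simp
  also have "\<dots> \<le> 3 ^ length is * fact (length is) / r ^ (length is + 2)"
    using assms pole_pos[of "e k" "P k" x] pos(3)[of k]
    by (intro divide_left_mono power_mono mult_pos_pos zero_less_power) auto
  finally show ?thesis
    using mult_right_mono[of _ _ "c k"] pos(1)[of k] by (fastforce simp: summand_def abs_mult)
qed

lemma abs_summand_le_global:
  "\<bar>summand k is x\<bar> \<le> 3 ^ length is * fact (length is) * (c k / e k ^ (length is + 2))"
proof (rule abs_summand_le)
  show "e k \<le> sqrt (pole (P k) (e k) x)"
    unfolding pole_def by (rule real_le_rsqrt) simp
qed (rule pos)

lemma abs_summand_le_T: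
  assumes "x \<in> T k"
  shows "\<bar>summand k is x\<bar> \<le> 3 ^ length is * fact (length is) * ((1 / 2) ^ k * M (length is))"
proof -
  have "dist x (P k) \<le> sqrt (pole (P k) (e k) x)"
    unfolding pole_def dist_norm by (rule real_le_rsqrt) simp
  then have "d k \<le> sqrt (pole (P k) (e k) x)" using T_away[OF assms] by linarith
  from abs_summand_le[OF pos(2) this]
  have "\<bar>summand k is x\<bar> \<le> 3 ^ length is * fact (length is) * (c k / d k ^ (length is + 2))" .
  also have "\<dots> \<le> 3 ^ length is * fact (length is) * ((1 / 2) ^ k * M (length is))"
    by (intro mult_left_mono small_T) auto
  finally show ?thesis .
qed

text \<open>For a fixed order only finitely many k violate n + 2 \<le> 2k + 1, so smallness at low
  orders is enough to make the sum smooth.\<close>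

lemma summable_summand_bound:
  "summable (\<lambda>k. 3 ^ n * fact n * (c k / e k ^ (n + 2)))"
proof (rule summable_comparison_test')
  show "summable (\<lambda>k. 3 ^ n * fact n * (1 / 2 :: real) ^ k)"
    by (intro summable_mult summable_geometric) auto
  show "norm (3 ^ n * fact n * (c k / e k ^ (n + 2))) \<le> 3 ^ n * fact n * (1 / 2 :: real) ^ k" if "k \<ge> n + 1" for k
  proof -
    have "0 \<le> 3 ^ n * fact n * (c k / e k ^ (n + 2))" using pos[of k] by (simp add: less_imp_le)
    then have "norm (3 ^ n * fact n * (c k / e k ^ (n + 2))) = 3 ^ n * fact n * (c k / e k ^ (n + 2))"
      unfolding real_norm_def by (rule abs_of_nonneg)
    also have "\<dots> \<le> 3 ^ n * fact n * (1 / 2 :: real) ^ k"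
      using that by (intro mult_left_mono small) auto
    finally show ?thesis .
  qed
qed

lemma summable_summand: "summable (\<lambda>k. summand k is x)"
  by (rule summable_comparison_test'[OF summable_summand_bound]) (use abs_summand_le_global in auto)

lemma total_derivs_on: "derivs_on UNIV total"
  unfolding total_def
proof (rule derivs_on_suminf)
  have "derivs_on UNIV (\<lambda>is x. foldr partial is (\<lambda>x. 1 / pole (P k) (e k) x) x *\<^sub>R c k)" for k
    using pos(3)[of k] by (intro derivs_on_scaleR_const inverse_pole_derivs_on) simp
  then show "derivs_on UNIV (summand k)" for k unfolding summand_def derivs_on_def by blast
  show "norm (summand k is x) \<le> 3 ^ length is * fact (length is) * (c k / e k ^ (length is + 2))" for k "is" x
    using abs_summand_le_global by simp
qed (use summable_summand_bound in auto)

text \<open>The finitely many terms with k < K have analytic bounds in 1 / e k; the others obey the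
  Denjoy-Carleman bounds on \<open>W\<close> with summable weights.\<close>

lemma total_bounds:
  assumes "\<And>k. k \<ge> K \<Longrightarrow> W \<subseteq> T k"
  shows "\<exists>A>0. \<exists>B>0. \<forall>is. \<forall>y\<in>W. \<bar>total is y\<bar> \<le> A * B ^ length is * fact (length is) * M (length is)"
proof -
  \<comment> \<open>The sum dominates each 1 / e k with k < K, and the summand 1 lets the tail share
    the constant. The 2 in \<open>A\<close> is the sum of the weights (1/2)^k.\<close>
  define B where "B = 1 + (\<Sum>k<K. 1 / e k)"
  define A where "A = 2 + (\<Sum>k<K. c k / (e k)\<^sup>2)"
  have B0: "(\<Sum>k<K. 1 / e k) \<ge> 0" using pos by (intro sum_nonneg) (simp add: less_imp_le)
  have B1: "B \<ge> 1" using B0 by (simp add: B_def)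
  have Bk: "1 / e k \<le> B" if "k < K" for k
  proof -
    have "1 / e k \<le> (\<Sum>k<K. 1 / e k)" using that pos by (intro member_le_sum) (auto simp: less_imp_le)
    then show ?thesis by (simp add: B_def)
  qed
  have "(\<Sum>k<K. c k / (e k)\<^sup>2) \<ge> 0" using pos by (intro sum_nonneg) (simp add: less_imp_le)
  then have A: "A > 0" by (simp add: A_def)
  have "\<bar>total is y\<bar> \<le> A * (3 * B) ^ length is * fact (length is) * M (length is)" if y: "y \<in> W" for "is" y
  proof -
    let ?n = "length is"
    define Z where "Z = (3 * B) ^ ?n * fact ?n * M ?n"
    have Z: "Z \<ge> 0" using B1 M_ge_one[of ?n] by (simp add: Z_def)
    have g: "(\<lambda>k. ((if k < K then c k / (e k)\<^sup>2 else 0) + (1 / 2) ^ k) * Z) sums (A * Z)"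
    proof -
      have "(\<lambda>k. if k < K then c k / (e k)\<^sup>2 else 0) sums (\<Sum>k<K. c k / (e k)\<^sup>2)"
        using sums_If_finite_set[of "{..<K}" "\<lambda>k. c k / (e k)\<^sup>2"] by simp
      moreover have "(\<lambda>k. (1 / 2 :: real) ^ k) sums 2" using geometric_sums[of "1 / 2 :: real"] by simp
      ultimately have "(\<lambda>k. (if k < K then c k / (e k)\<^sup>2 else 0) + (1 / 2) ^ k) sums A"
        unfolding A_def by (subst add.commute) (rule sums_add)
      then show ?thesis by (rule sums_mult2)
    qed
    have "norm (summand k is y) \<le> ((if k < K then c k / (e k)\<^sup>2 else 0) + (1 / 2) ^ k) * Z" for k
    proof (cases "k < K")
      case True
      have "norm (summand k is y) \<le> 3 ^ ?n * fact ?n * (c k / e k ^ (?n + 2))"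
        using abs_summand_le_global by simp
      also have "\<dots> = 3 ^ ?n * fact ?n * (c k / (e k)\<^sup>2 * (1 / e k) ^ ?n * 1)"
        by (simp add: power_add power_one_over power2_eq_square)
      also have "\<dots> \<le> 3 ^ ?n * fact ?n * (c k / (e k)\<^sup>2 * B ^ ?n * M ?n)"
        using pos[of k] Bk[OF True] M_ge_one B1
        by (intro mult_left_mono mult_mono power_mono) (auto simp: less_imp_le)
      also have "\<dots> = c k / (e k)\<^sup>2 * Z" by (simp add: Z_def power_mult_distrib)
      also have "\<dots> \<le> (c k / (e k)\<^sup>2 + (1 / 2) ^ k) * Z" using Z by (intro mult_right_mono) auto
      finally show ?thesis using True by simp
    next
      case False
      then have "y \<in> T k" using assms[of k] y by auto
      then have "norm (summand k is y) \<le> 3 ^ ?n * fact ?n * ((1 / 2) ^ k * M ?n)"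
        using abs_summand_le_T by simp
      also have "\<dots> = (1 / 2) ^ k * (3 ^ ?n * 1 ^ ?n * fact ?n * M ?n)" by simp
      also have "\<dots> \<le> (1 / 2) ^ k * (3 ^ ?n * B ^ ?n * fact ?n * M ?n)"
        using B1 order_trans[OF zero_le_one M_ge_one]
        by (intro mult_left_mono mult_right_mono power_mono) auto
      finally show ?thesis using False by (simp add: Z_def power_mult_distrib)
    qed
    then have "norm (total is y) \<le> A * Z"
      unfolding total_def sums_unique[OF g] by (intro norm_suminf_le sums_summable[OF g])
    then show ?thesis by (simp add: Z_def mult.assoc)
  qed
  then show ?thesis using A B1 by (intro exI[of _ A] conjI exI[of _ "3 * B"]) auto
qed

text \<open>\<open>P k\<close> lies in \<open>T j\<close> for every j \<noteq> k, so the other terms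
  contribute at most 2 * 3^(2k) (2k)! M (2k) against the prescribed size of the k-th.\<close>

lemma total_at_center:
  "fact (2 * k) * M (2 * k) * (real k ^ (2 * k) - 2 * 3 ^ (2 * k)) \<le> \<bar>total (replicate (2 * k) i) (P k)\<bar>"
proof -
  let ?is = "replicate (2 * k) i" and ?N = "2 * k"
  define Z where "Z = 3 ^ ?N * fact ?N * M ?N"
  have Z: "Z \<ge> 0" using M_ge_one[of ?N] by (simp add: Z_def)
  have main: "\<bar>summand k ?is (P k)\<bar> = fact ?N * M ?N * real k ^ ?N"
  proof -
    have "\<bar>summand k ?is (P k)\<bar> = fact ?N / e k ^ (?N + 2) * c k"
      unfolding summand_def using inverse_pole_partial_center[of "e k" k i "P k"] pos[of k]
      by (simp add: abs_mult)
    also have "\<dots> = fact ?N * (c k / e k ^ (?N + 2))" by simp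
    finally show ?thesis unfolding large by (simp add: mult_ac)
  qed
  have "(\<lambda>j. summand j ?is (P k) - (if j = k then summand j ?is (P k) else 0)) sums
      (total ?is (P k) - summand k ?is (P k))"
    unfolding total_def by (intro sums_diff summable_sums summable_summand sums_single)
  moreover have g: "(\<lambda>j. (1 / 2) ^ j * Z) sums (2 * Z)"
    using sums_mult2[OF geometric_sums[of "1 / 2 :: real"], of Z] by simp
  moreover have "norm (summand j ?is (P k) - (if j = k then summand j ?is (P k) else 0)) \<le> (1 / 2) ^ j * Z" for j
    using abs_summand_le_T[OF separated[of j k], of ?is] mult_nonneg_nonneg[OF _ Z, of "(1 / 2) ^ j"]
    by (auto simp: Z_def mult_ac)
  ultimately have "norm (total ?is (P k) - summand k ?is (P k)) \<le> 2 * Z"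
    using norm_suminf_le[of "\<lambda>j. summand j ?is (P k) - (if j = k then summand j ?is (P k) else 0)" "\<lambda>j. (1 / 2) ^ j * Z"]
    by (metis (no_types, lifting) sums_summable sums_unique)
  then have "\<bar>summand k ?is (P k)\<bar> - 2 * Z \<le> \<bar>total ?is (P k)\<bar>" by simp
  then show ?thesis unfolding main by (simp add: Z_def algebra_simps)
qed

end

subsection \<open>Poles on a flat curve\<close>

text \<open>With u = 2^-k the second coordinate is half of u^(k+1) / (k+1): the growing exponent
  undercuts every u^m and the factor 1 / (k+1) every a > 0.\<close>

definition center :: "'p::finite \<Rightarrow> 'p \<Rightarrow> nat \<Rightarrow> real^'p" where
  "center i\<^sub>1 i\<^sub>2 k = (\<chi> i. if i = i\<^sub>1 then (1 / 2) ^ k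
     else if i = i\<^sub>2 then ((1 / 2) ^ k) ^ (k + 1) / (2 * (real k + 1)) else 0)"

text \<open>The first two pieces cover the complement of the quadrant and the fourth the other
  centres. For large k, the third covers a given \<open>S_set\<close> near 0 and the fifth a given
  set bounded away from 0.\<close>

definition away :: "'p::finite \<Rightarrow> 'p \<Rightarrow> nat \<Rightarrow> (real^'p) set" where
  "away i\<^sub>1 i\<^sub>2 k = {x. x $ i\<^sub>1 \<le> 0} \<union> {x. x $ i\<^sub>2 \<le> 0} \<union> {x. x $ i\<^sub>1 ^ (k + 1) / (real k + 1) \<le> x $ i\<^sub>2}
     \<union> {x. (1 / 2) ^ k / 2 \<le> \<bar>x $ i\<^sub>1 - (1 / 2) ^ k\<bar>} \<union> {x. 3 * (1 / 2) ^ k \<le> norm x}"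

lemma closed_away: "closed (away i\<^sub>1 i\<^sub>2 k)"
  unfolding away_def by (intro closed_Un closed_Collect_le continuous_intros) auto

lemma norm_center_le:
  assumes "i\<^sub>1 \<noteq> i\<^sub>2"
  shows "norm (center i\<^sub>1 i\<^sub>2 k) \<le> 2 * (1 / 2) ^ k"
proof -
  define u :: real where "u = (1 / 2) ^ k"
  have u: "0 < u" "u \<le> 1" by (auto simp: u_def power_le_one)
  have "u ^ (k + 1) / (2 * (real k + 1)) \<le> u ^ (k + 1) / 1" using u by (intro divide_left_mono) auto
  also have "\<dots> = u * u ^ k" by simp
  also have "\<dots> \<le> u" using u by (simp add: mult_left_le power_le_one)
  finally have y: "u ^ (k + 1) / (2 * (real k + 1)) \<le> u" .
  have "norm (center i\<^sub>1 i\<^sub>2 k) \<le> (\<Sum>i\<in>UNIV. \<bar>center i\<^sub>1 i\<^sub>2 k $ i\<bar>)" by (rule norm_le_l1_cart)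
  also have "\<dots> = (\<Sum>i\<in>{i\<^sub>1, i\<^sub>2}. \<bar>center i\<^sub>1 i\<^sub>2 k $ i\<bar>)"
    by (rule sum.mono_neutral_right) (auto simp: center_def)
  also have "\<dots> = u + u ^ (k + 1) / (2 * (real k + 1))"
    using assms u by (simp add: center_def u_def[symmetric])
  finally show ?thesis using y unfolding u_def by linarith
qed

text \<open>The half in the second coordinate avoids the third piece; the constant 3 against the 2
  of \<open>norm_center_le\<close> avoids the fifth.\<close>

lemma center_notin_away:
  assumes "i\<^sub>1 \<noteq> i\<^sub>2"
  shows "center i\<^sub>1 i\<^sub>2 k \<notin> away i\<^sub>1 i\<^sub>2 k"
proof -
  define u :: real where "u = (1 / 2) ^ k"
  have u: "0 < u" by (auto simp: u_def)
  define v w where "v = u ^ (k + 1) / (2 * (real k + 1))" and "w = u ^ (k + 1) / (real k + 1)"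
  have c: "center i\<^sub>1 i\<^sub>2 k $ i\<^sub>1 = u" "center i\<^sub>1 i\<^sub>2 k $ i\<^sub>2 = v"
    using assms by (auto simp: center_def u_def v_def)
  have "v < w" unfolding v_def w_def using u by (intro divide_strict_left_mono) auto
  moreover have "v > 0" using u by (simp add: v_def)
  ultimately show ?thesis
    using u norm_center_le[OF assms, of k]
    unfolding away_def Un_iff mem_Collect_eq c u_def[symmetric] w_def[symmetric] by auto
qed

text \<open>Distinct powers of 1/2 differ by at least half of either one, so the first coordinate
  alone puts the centre into the fourth piece.\<close>

lemma center_in_away:
  assumes "j \<noteq> k"
  shows "center i\<^sub>1 i\<^sub>2 k \<in> away i\<^sub>1 i\<^sub>2 j"
proof -
  have "(1 / 2 :: real) ^ j / 2 \<le> \<bar>(1 / 2) ^ k - (1 / 2) ^ j\<bar>"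
  proof (cases "j < k")
    case True
    have "(1 / 2 :: real) ^ k \<le> (1 / 2) ^ Suc j" using True by (intro power_decreasing) auto
    then show ?thesis unfolding power_Suc by linarith
  next
    case False
    then have "(1 / 2 :: real) ^ j \<le> (1 / 2) ^ Suc k" using assms by (intro power_decreasing) auto
    moreover have "(1 / 2 :: real) ^ j > 0" by simp
    ultimately show ?thesis unfolding power_Suc by linarith
  qed
  then show ?thesis by (simp add: away_def center_def)
qed

text \<open>Makes pure derivatives along one axis an instance of \<open>mderiv\<close>, so that
  their size at the centres can refute \<open>dc_bounds\<close>.\<close>

lemma mindex_single:
  fixes i :: "'p::finite"
  shows "mindex (\<lambda>j. if j = i then n else 0) coords = replicate n i"
proof -
  let ?\<alpha> = "\<lambda>j. if j = i then n else 0"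
  obtain as bs where s: "coords = as @ i # bs" using coords(2) split_list by (metis UNIV_I)
  have d: "i \<notin> set as" "i \<notin> set bs" using coords(1)[where 'p = 'p] unfolding s by auto
  have "mindex ?\<alpha> (as @ i # bs) = mindex ?\<alpha> (i # bs)" using d by (intro mindex_append_zero) auto
  also have "\<dots> = replicate n i @ mindex ?\<alpha> (bs @ [])" by (simp add: mindex_def)
  also have "mindex ?\<alpha> (bs @ []) = mindex ?\<alpha> []" using d by (intro mindex_append_zero) auto
  finally show ?thesis unfolding s by (simp add: mindex_def)
qed

section \<open>Bounds for the sum of poles and their failure at the limit of the centres\<close>

context pole_series
begin

text \<open>Scaling the unit of the algebra embeds the real sum, with its norms, into the real and
  the complex numbers alike.\<close>

lemma dc_bounds_total:
  fixes f :: "real^'p \<Rightarrow> 'f::{banach,real_normed_algebra_1}"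
  assumes f: "f = (\<lambda>x. total [] x *\<^sub>R 1)" and W: "\<And>k. k \<ge> K \<Longrightarrow> W \<subseteq> T k"
  shows "dc_bounds M W f"
proof -
  obtain A B where AB: "A > 0" "B > 0"
    "\<And>is y. y \<in> W \<Longrightarrow> \<bar>total is y\<bar> \<le> A * B ^ length is * fact (length is) * M (length is)"
    using total_bounds[OF W] by blast
  have "foldr partial is f y = total is y *\<^sub>R 1" for "is" y
    by (rule derivs_on_foldr_partial[OF derivs_on_scaleR_const[OF total_derivs_on] open_UNIV]) (auto simp: f)
  then show ?thesis using AB by (intro dc_boundsI[OF AB(1,2)]) simp
qed

lemma not_dc_open_total:
  fixes f :: "real^'p \<Rightarrow> 'f::{banach,real_normed_algebra_1}"
  assumes f: "f = (\<lambda>x. total [] x *\<^sub>R 1)" and P: "P \<longlonglongrightarrow> x\<^sub>0" and x0: "x\<^sub>0 \<in> U"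
  shows "\<not> dc_open M U f"
proof
  assume "dc_open M U f"
  then obtain V where V: "open V" "x\<^sub>0 \<in> V" "dc_bounds M V f" using x0 unfolding dc_open_def by blast
  then obtain A B where A: "A > 0" and B: "B > 0"
    and b: "\<And>\<alpha> y. y \<in> V \<Longrightarrow> norm (mderiv \<alpha> f y) \<le> A * B ^ mlen \<alpha> * fact (mlen \<alpha>) * M (mlen \<alpha>)"
    unfolding dc_bounds_def by blast
  have "\<forall>\<^sub>F k in sequentially. P k \<in> V" using P V(1,2) by (rule topological_tendstoD)
  then obtain K where K: "\<And>k. k \<ge> K \<Longrightarrow> P k \<in> V" unfolding eventually_sequentially by blast
  \<comment> \<open>A common base for the assumed bound with B and for the contribution 3^(2k) of
    the other poles.\<close>
  define q where "q = max B 3"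
  have q: "q \<ge> 3" "q \<ge> B" by (auto simp: q_def)
  \<comment> \<open>Large enough for \<open>P k\<close> to lie in \<open>V\<close> and for k / q
    \<ge> A + 3, against the bound (k / q)^(2k) \<le> A + 2 derived below.\<close>
  define k where "k = max K (nat \<lceil>q * (A + 3)\<rceil>)"
  have "real k \<ge> q * (A + 3)" unfolding k_def by linarith
  then have kq: "A + 3 \<le> real k / q" using q by (simp add: field_simps)
  fix i :: 'p
  let ?\<alpha> = "\<lambda>j. if j = i then 2 * k else 0"
  have \<alpha>: "mlen ?\<alpha> = 2 * k" by (simp add: mlen_def)
  have eq: "foldr partial is f y = total is y *\<^sub>R 1" for "is" y
    by (rule derivs_on_foldr_partial[OF derivs_on_scaleR_const[OF total_derivs_on] open_UNIV]) (auto simp: f)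
  have "norm (mderiv ?\<alpha> f (P k)) = \<bar>total (replicate (2 * k) i) (P k)\<bar>"
    unfolding mderiv_eq mindex_single eq by simp
  then have "\<bar>total (replicate (2 * k) i) (P k)\<bar> \<le> fact (2 * k) * M (2 * k) * (A * B ^ (2 * k))"
    using b[OF K, of k ?\<alpha>] unfolding \<alpha> by (simp add: k_def mult_ac)
  from order_trans[OF total_at_center this] have
    "fact (2 * k) * M (2 * k) * (real k ^ (2 * k) - 2 * 3 ^ (2 * k)) \<le> fact (2 * k) * M (2 * k) * (A * B ^ (2 * k))" .
  then have "real k ^ (2 * k) - 2 * 3 ^ (2 * k) \<le> A * B ^ (2 * k)"
    using M_ge_one[of "2 * k"] by (simp add: mult_le_cancel_left)
  also have "\<dots> \<le> A * q ^ (2 * k)" using A B q by (intro mult_left_mono power_mono) auto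
  finally have "real k ^ (2 * k) \<le> A * q ^ (2 * k) + 2 * 3 ^ (2 * k)" by simp
  also have "\<dots> \<le> A * q ^ (2 * k) + 2 * q ^ (2 * k)" using q by (intro add_left_mono mult_left_mono power_mono) auto
  finally have "(real k / q) ^ (2 * k) \<le> A + 2" using q by (simp add: power_divide field_simps)
  moreover have "real k / q \<le> (real k / q) ^ (2 * k)"
  proof (rule self_le_power)
    show "1 \<le> real k / q" using kq A by linarith
    then show "0 < 2 * k" by (cases "k = 0") auto
  qed
  ultimately show False using kq by linarith
qed

end

section \<open>The function with centres on the flat curve\<close>

lemma dc_open_imp_local_dc_bounds:
  assumes "dc_open M U f" "x \<in> U"
  shows "\<exists>V. open V \<and> x \<in> V \<and> dc_bounds M (V \<inter> C) f"
proof -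
  obtain V where "open V" "x \<in> V" "dc_bounds M V f" using assms unfolding dc_open_def by blast
  then show ?thesis using dc_bounds_subset[of M V f "V \<inter> C"] by blast
qed

lemma flat_singularity_exists:
  fixes M :: "nat \<Rightarrow> real" and i\<^sub>1 i\<^sub>2 :: "'p::finite"
  assumes M: "weight_seq M" and ne: "i\<^sub>1 \<noteq> i\<^sub>2"
    and na: "\<not> is_analytic_class M TYPE(real^'p) TYPE('f::{banach,real_normed_algebra_1})"
  shows "\<exists>f :: real^'p \<Rightarrow> 'f.
              smooth_on UNIV f \<and>
              dc_open M (UNIV - {0}) f \<and>
              (\<forall>a>0. \<forall>m\<ge>1. dc_closed M (S_set i\<^sub>1 i\<^sub>2 a m) f) \<and>
              dc_closed M (UNIV - Q_set i\<^sub>1 i\<^sub>2) f \<and>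
              \<not> dc_open M UNIV f"
proof -
  have unb: "\<exists>n. M n > C ^ n" if "C > 0" for C
    using is_analytic_classI[OF M that, where 'p = 'p and 'f = 'f] na by (meson not_le)
  have "\<exists>d. 0 < d \<and> d \<le> 1 \<and> (\<forall>x\<in>away i\<^sub>1 i\<^sub>2 k. d \<le> dist x (center i\<^sub>1 i\<^sub>2 k))" for k
  proof -
    have "open (- away i\<^sub>1 i\<^sub>2 k)" "center i\<^sub>1 i\<^sub>2 k \<in> - away i\<^sub>1 i\<^sub>2 k"
      using closed_away center_notin_away[OF ne] by auto
    then obtain r where r: "r > 0" "ball (center i\<^sub>1 i\<^sub>2 k) r \<subseteq> - away i\<^sub>1 i\<^sub>2 k" using openE by blast
    \<comment> \<open>The cap 1 provides the hypothesis d \<le> 1 of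
      \<open>pole_parameters\<close>.\<close>
    then have "min r 1 \<le> dist x (center i\<^sub>1 i\<^sub>2 k)" if "x \<in> away i\<^sub>1 i\<^sub>2 k" for x
    proof -
      have "x \<notin> ball (center i\<^sub>1 i\<^sub>2 k) r" using r(2) that by blast
      then show ?thesis by (simp add: dist_commute not_less min.coboundedI1)
    qed
    then show ?thesis using r(1) by (intro exI[of _ "min r 1"]) auto
  qed
  then obtain d where d: "\<And>k. 0 < d k" "\<And>k. d k \<le> 1"
    "\<And>k x. x \<in> away i\<^sub>1 i\<^sub>2 k \<Longrightarrow> d k \<le> dist x (center i\<^sub>1 i\<^sub>2 k)" by metis
  have "\<exists>c e. c > 0 \<and> e > 0 \<and> (\<forall>n. n + 2 \<le> 2 * k + 1 \<longrightarrow> c / e ^ (n + 2) \<le> (1 / 2) ^ k)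
    \<and> (\<forall>n. c / d k ^ (n + 2) \<le> (1 / 2) ^ k * M n)
    \<and> c / e ^ (2 * k + 2) = real k ^ (2 * k) * M (2 * k)" for k
    by (rule pole_parameters[OF M unb d(1,2)])
  then obtain c e where ce: "\<And>k. c k > 0" "\<And>k. e k > 0"
    "\<And>k n. n + 2 \<le> 2 * k + 1 \<Longrightarrow> c k / e k ^ (n + 2) \<le> (1 / 2) ^ k"
    "\<And>k n. c k / d k ^ (n + 2) \<le> (1 / 2) ^ k * M n"
    "\<And>k. c k / e k ^ (2 * k + 2) = real k ^ (2 * k) * M (2 * k)"
    by metis
  interpret pole_series M "center i\<^sub>1 i\<^sub>2" "away i\<^sub>1 i\<^sub>2" c d e
    by unfold_locales (use weight_seq_ge_one[OF M] d ce center_in_away in auto)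
  define f :: "real^'p \<Rightarrow> 'f" where "f = (\<lambda>x. total [] x *\<^sub>R 1)"
  have smooth: "smooth_on UNIV f"
    by (rule derivs_on_smooth_on[OF derivs_on_scaleR_const[OF total_derivs_on, of "1 :: 'f"]]) (auto simp: f_def)
  have "dc_open M (UNIV - {0}) f"
    unfolding dc_open_def
  proof (intro conjI ballI)
    show "smooth_on (UNIV - {0}) f" using smooth by (auto simp: smooth_on_def)
    fix x :: "real^'p" assume x: "x \<in> UNIV - {0}"
    \<comment> \<open>For k \<ge> K this makes 3 * 2^-k less than norm x / 2, so the fifth piece of
      \<open>away\<close> contains the ball of that radius around x.\<close>
    obtain K where K: "(1 / 2 :: real) ^ K < norm x / 6"
      using real_arch_pow_inv[of "norm x / 6" "1 / 2"] x by auto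
    have V: "norm y \<ge> norm x / 2" if "y \<in> ball x (norm x / 2)" for y
      using that norm_triangle_ineq2[of x "x - y"] by (simp add: dist_norm)
    have "dc_bounds M (ball x (norm x / 2)) f"
    proof (rule dc_bounds_total[OF f_def])
      fix k assume "k \<ge> K"
      then have "(1 / 2 :: real) ^ k \<le> (1 / 2) ^ K" by (intro power_decreasing) auto
      then have "3 * (1 / 2) ^ k \<le> norm y" if "y \<in> ball x (norm x / 2)" for y
        using V[OF that] K by linarith
      then show "ball x (norm x / 2) \<subseteq> away i\<^sub>1 i\<^sub>2 k" by (auto simp: away_def)
    qed
    moreover have "ball x (norm x / 2) \<subseteq> UNIV - {0}" using V x by fastforce
    ultimately show "\<exists>V. open V \<and> x \<in> V \<and> V \<subseteq> UNIV - {0} \<and> dc_bounds M V f"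
      using x by (intro exI[of _ "ball x (norm x / 2)"]) auto
  qed
  moreover have "dc_closed M (S_set i\<^sub>1 i\<^sub>2 a m) f" if a: "a > 0" for a m
    unfolding dc_closed_def
  proof (intro conjI ballI)
    show "\<exists>U. open U \<and> S_set i\<^sub>1 i\<^sub>2 a m \<subseteq> U \<and> smooth_on U f" using smooth by blast
    fix x assume "x \<in> S_set i\<^sub>1 i\<^sub>2 a m"
    show "\<exists>V. open V \<and> x \<in> V \<and> dc_bounds M (V \<inter> S_set i\<^sub>1 i\<^sub>2 a m) f"
    proof (cases "x = 0")
      case False
      then show ?thesis using dc_open_imp_local_dc_bounds[OF \<open>dc_open M (UNIV - {0}) f\<close>] by blast
    next
      case True
      have "dc_bounds M (ball 0 1 \<inter> S_set i\<^sub>1 i\<^sub>2 a m) f"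
      proof (rule dc_bounds_total[OF f_def], rule subsetI)
        \<comment> \<open>For 0 \<le> t \<le> 1, k \<ge> m and k + 1 \<ge> 1 / a one has t^(k+1) /
          (k+1) \<le> a t^m, which is the third piece of \<open>away\<close>.\<close>
        fix k y assume k: "k \<ge> max m (nat \<lceil>1 / a\<rceil>)" and y: "y \<in> ball 0 1 \<inter> S_set i\<^sub>1 i\<^sub>2 a m"
        have "1 / a \<le> real k" using k by linarith
        then have "1 \<le> a * (real k + 1)" using a by (simp add: field_simps)
        then have ka: "1 / (real k + 1) \<le> a" by (simp add: field_simps)
        have y1: "0 \<le> y $ i\<^sub>1" "y $ i\<^sub>1 \<le> 1" "a * (y $ i\<^sub>1) ^ m \<le> y $ i\<^sub>2"
          using y component_le_norm_cart[of y i\<^sub>1] by (auto simp: S_set_def)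
        have "1 / (real k + 1) * (y $ i\<^sub>1) ^ (k + 1) \<le> a * (y $ i\<^sub>1) ^ m"
          using ka y1 k a by (intro mult_mono power_decreasing) auto
        then show "y \<in> away i\<^sub>1 i\<^sub>2 k" using y1(3) by (simp add: away_def)
      qed
      then show ?thesis using True by (intro exI[of _ "ball 0 1"]) auto
    qed
  qed
  moreover have "dc_closed M (UNIV - Q_set i\<^sub>1 i\<^sub>2) f"
  proof -
    \<comment> \<open>The first two pieces of every \<open>away\<close> set contain the complement
      of the quadrant, so no initial terms have to be split off.\<close>
    have "dc_bounds M (UNIV - Q_set i\<^sub>1 i\<^sub>2) f"
      by (rule dc_bounds_total[OF f_def, of 0]) (auto simp: Q_set_def away_def not_less)
    then have "dc_bounds M (UNIV \<inter> (UNIV - Q_set i\<^sub>1 i\<^sub>2)) f" by simp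
    then show ?thesis unfolding dc_closed_def using smooth by blast
  qed
  moreover have "\<not> dc_open M UNIV f"
  proof (rule not_dc_open_total[OF f_def])
    show "center i\<^sub>1 i\<^sub>2 \<longlonglongrightarrow> 0"
    proof (rule Lim_null_comparison)
      show "\<forall>\<^sub>F k in sequentially. norm (center i\<^sub>1 i\<^sub>2 k) \<le> 2 * (1 / 2) ^ k"
        using norm_center_le[OF ne] by simp
      show "(\<lambda>k. 2 * (1 / 2 :: real) ^ k) \<longlonglongrightarrow> 0"
        using tendsto_mult_left[OF LIMSEQ_power_zero[of "1 / 2 :: real"], of 2] by simp
    qed
  qed simp
  ultimately show ?thesis using smooth by blast
qed

theorem theorem1p4:
  fixes M :: "nat \<Rightarrow> real" and i\<^sub>1 i\<^sub>2 :: "'p::finite"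
  assumes "weight_seq M"
    and "CARD('p) \<ge> 2"
    and "i\<^sub>1 \<noteq> i\<^sub>2"
  shows "(\<not> is_analytic_class M TYPE(real^'p) TYPE(real) \<longrightarrow>
           (\<exists>f :: real^'p \<Rightarrow> real.
              smooth_on UNIV f \<and>
              dc_open M (UNIV - {0}) f \<and>
              (\<forall>a>0. \<forall>m\<ge>1. dc_closed M (S_set i\<^sub>1 i\<^sub>2 a m) f) \<and>
              dc_closed M (UNIV - Q_set i\<^sub>1 i\<^sub>2) f \<and>
              \<not> dc_open M UNIV f))
       \<and> (\<not> is_analytic_class M TYPE(real^'p) TYPE(complex) \<longrightarrow>
           (\<exists>f :: real^'p \<Rightarrow> complex.
              smooth_on UNIV f \<and>
              dc_open M (UNIV - {0}) f \<and>
              (\<forall>a>0. \<forall>m\<ge>1. dc_closed M (S_set i\<^sub>1 i\<^sub>2 a m) f) \<and>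
              dc_closed M (UNIV - Q_set i\<^sub>1 i\<^sub>2) f \<and>
              \<not> dc_open M UNIV f))"
  using flat_singularity_exists[OF assms(1,3), where 'f = real]
    flat_singularity_exists[OF assms(1,3), where 'f = complex] by blast

end
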